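(* Let $\{H_n\}_{n=1}^\infty$ be a Positive Linear Recurrence Sequence and let $K_n$ be the number of summands in the legal decomposition of an integer chosen uniformly at random from $[H_n,H_{n+1})$. The mean $\mu_n$ and variance $\sigma_n^2$ of $K_n$ grow linearly in $n$ (i.e. each is of exact order $n$: bounded above and below by positive constant multiples of $n$ for all large $n$), and $(K_n-\mu_n)/\sigma_n$ converges weakly to the standard normal $N(0,1)$ as $n\to\infty$.
   Context: A Positive Linear Recurrence Sequence is a sequence $\{H_n\}_{n\ge1}$ of positive integers for which there are non-negative integers $L,c_1,\dots,c_L$ with $L,c_1,c_L$ positive such that $H_1=1$, $H_{n+1}=c_1H_n+c_2H_{n-1}+\cdots+c_nH_1+1$ for $1\le n<L$, and $H_{n+1}=c_1H_n+\cdots+c_LH_{n+1-L}$ for $n\ge L$. When $L=1$ it is assumed that $c_1>1$. A decomposition $\sum_{i=1}^{m} a_iH_{m+1-i}$ of a positive integer (and the integer sequence $\{a_i\}_{i=1}^m$) is called legal if $a_1>0$, the other $a_i\ge0$, and one of the following holds. Condition 1: $m<L$ and $a_i=c_i$ for $1\le i\le m$. Condition 2: there exists $s\in\{1,\dots,L\}$ such that $a_1=c_1,\dots,a_{s-1}=c_{s-1}$ and $a_s<c_s$, $a_{s+1}=\cdots=a_{s+\ell}=0$ for some $\ell\ge0$, and the sequence $\{b_i\}_{i=1}^{m-s-\ell}$ with $b_i=a_{s+\ell+i}$ is legal. The empty sequence (representing $0$) counts as legal. The number of summands of the decomposition is $a_1+\cdots+a_m$. Every positive integer has a unique legal decomposition.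 *)

theory Defs
  imports "HOL-Probability.Probability" "HOL-Library.Landau_Symbols"
begin

text \<open>Sequences are indexed from 1: \<open>c 0\<close>, \<open>H 0\<close> and \<open>c i\<close> for \<open>i > L\<close> are irrelevant.\<close>

definition positive_linear_recurrence :: "nat \<Rightarrow> (nat \<Rightarrow> nat) \<Rightarrow> (nat \<Rightarrow> nat) \<Rightarrow> bool" where
  "positive_linear_recurrence L c H \<longleftrightarrow>
     L > 0 \<and> c 1 > 0 \<and> c L > 0 \<and> (L = 1 \<longrightarrow> c 1 > 1) \<and>
     (\<forall>n\<ge>1. H n > 0) \<and>
     H 1 = 1 \<and>
     (\<forall>n. 1 \<le> n \<and> n < L \<longrightarrow> H (n + 1) = (\<Sum>i=1..n. c i * H (n + 1 - i)) + 1) \<and>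
     (\<forall>n\<ge>L. H (n + 1) = (\<Sum>i=1..L. c i * H (n + 1 - i)))"

text \<open>A coefficient sequence \<open>a\<^sub>1, \<dots>, a\<^sub>m\<close> is a list \<open>as\<close> with \<open>a\<^sub>i = as ! (i - 1)\<close>.\<close>

inductive legal :: "nat \<Rightarrow> (nat \<Rightarrow> nat) \<Rightarrow> nat list \<Rightarrow> bool"
  for L :: nat and c :: "nat \<Rightarrow> nat" where
  legal_empty: "legal L c []"
| legal_initial:
    "\<lbrakk>as \<noteq> []; as ! 0 > 0; length as < L;
      \<forall>i\<in>{1..length as}. as ! (i - 1) = c i\<rbrakk> \<Longrightarrow> legal L c as"
| legal_block:
    "\<lbrakk>as \<noteq> []; as ! 0 > 0; s \<in> {1..L}; s + l \<le> length as;
      \<forall>i\<in>{1..<s}. as ! (i - 1) = c i;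
      as ! (s - 1) < c s;
      \<forall>i\<in>{s+1..s+l}. as ! (i - 1) = 0;
      legal L c (drop (s + l) as)\<rbrakk> \<Longrightarrow> legal L c as"

definition decomposition_value :: "(nat \<Rightarrow> nat) \<Rightarrow> nat list \<Rightarrow> nat" where
  "decomposition_value H as = (\<Sum>i=1..length as. as ! (i - 1) * H (length as + 1 - i))"

definition legal_decomposition ::
    "nat \<Rightarrow> (nat \<Rightarrow> nat) \<Rightarrow> (nat \<Rightarrow> nat) \<Rightarrow> nat \<Rightarrow> nat list" where
  "legal_decomposition L c H N = (THE as. legal L c as \<and> decomposition_value H as = N)"

definition num_summands :: "nat \<Rightarrow> (nat \<Rightarrow> nat) \<Rightarrow> (nat \<Rightarrow> nat) \<Rightarrow> nat \<Rightarrow> nat" where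
  "num_summands L c H N = sum_list (legal_decomposition L c H N)"

definition mean_summands :: "nat \<Rightarrow> (nat \<Rightarrow> nat) \<Rightarrow> (nat \<Rightarrow> nat) \<Rightarrow> nat \<Rightarrow> real" where
  "mean_summands L c H n =
     measure_pmf.expectation (pmf_of_set {H n..<H (n + 1)}) (\<lambda>N. real (num_summands L c H N))"

definition variance_summands :: "nat \<Rightarrow> (nat \<Rightarrow> nat) \<Rightarrow> (nat \<Rightarrow> nat) \<Rightarrow> nat \<Rightarrow> real" where
  "variance_summands L c H n =
     measure_pmf.variance (pmf_of_set {H n..<H (n + 1)}) (\<lambda>N. real (num_summands L c H N))"

end

theory Submission
  imports Defs
begin

text \<open>
  Read from the left, a legal string falls apart into blocks \<open>c\<^sub>1, \<dots>, c\<^sub>s\<^sub>-\<^sub>1, a\<close>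
  with \<open>a < c\<^sub>s\<close>, followed by a possibly incomplete last block. A block has length \<open>s\<close>
  and contributes \<open>k = c\<^sub>1 + \<dots> + c\<^sub>s\<^sub>-\<^sub>1 + a\<close> summands. The recurrence for \<open>H\<close> says that the
  values of strings with a given first block fill consecutive intervals, so legal strings of
  length \<open>n\<close> correspond to the integers in \<open>[H n, H (n + 1))\<close>, and the generating function
  \<open>p\<^sub>n(z) = \<Sum> exp (z k)\<close> over these strings satisfies a linear recurrence whose coefficients are
  the block sums \<open>\<Sum>\<^sub>a exp (z k)\<close>.

  Let \<open>\<rho> > 0\<close> be the root of \<open>\<Sum> c\<^sub>s \<rho>^s = 1\<close>. Giving a block of length \<open>s\<close> the probability
  \<open>\<rho>^s\<close> defines a random block with length \<open>S\<close> and number of summands \<open>K\<close>; put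
  \<open>\<mu> = E K / E S\<close> and \<open>\<sigma>\<^sup>2 = E (K - \<mu> S)\<^sup>2 / E S\<close>, as renewal theory suggests. There is no need to
  follow the dominant root of the characteristic polynomial as a function of \<open>z\<close>: the explicit
  factor \<open>\<rho>^(-1) exp (\<mu> z + \<sigma>\<^sup>2 z\<^sup>2 / 2)\<close> agrees with it up to \<open>O(z\<^sup>3)\<close>. After division of
  \<open>p\<^sub>n\<close> by its \<open>n\<close>-th power, the recurrence has coefficients whose sum is \<open>1 + O(\<bar>z\<bar>\<^sup>3)\<close> and whose
  absolute sum is \<open>1 + O(\<bar>z\<bar>\<^sup>2)\<close> (lemma \<open>tilted_sum_expansion\<close>). For \<open>\<bar>z\<bar> = O(n^(-1/2))\<close> neither
  error accumulates over \<open>n\<close> steps: the normalized sequence stays bounded, a weighted sum of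
  \<open>L\<close> consecutive terms is conserved up to \<open>o(1)\<close>, and the oscillation of \<open>L\<close> consecutive terms
  decays geometrically because \<open>c\<^sub>1 > 0\<close>. Therefore the normalized sequence tends to a nonzero
  constant that does not depend on the choice of \<open>z\<close> (lemma \<open>perturbed_renewal_limit\<close>), and
  comparison with \<open>z = 0\<close> gives \<open>E exp (\<zeta> X\<^sub>n) \<approx> exp (\<sigma>\<^sup>2 \<zeta>\<^sup>2 / 2)\<close> for
  \<open>X\<^sub>n = (K\<^sub>n - n \<mu>) / sqrt n\<close> and bounded complex \<open>\<zeta>\<close> (lemma \<open>transform_limit\<close>).

  Real \<open>\<zeta> = \<plusminus>1\<close> bounds the third moments of \<open>X\<^sub>n\<close>, imaginary \<open>\<zeta>\<close> gives the characteristic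
  functions; a Taylor expansion of the latter yields \<open>E X\<^sub>n \<longlonglongrightarrow> 0\<close> and
  \<open>Var X\<^sub>n \<longlonglongrightarrow> \<sigma>\<^sup>2\<close>, hence the growth rates, and Levy's continuity theorem gives the limit law
  (lemma \<open>clt_from_exponential_transforms\<close>). Both \<open>\<mu>\<close> and \<open>\<sigma>\<^sup>2\<close> are positive: some block has a
  summand, and the block consisting of one digit 0 deviates from the average rate \<open>\<mu>\<close>.

  Positions inside a block are counted from 0 below, so the pair \<open>(s, a)\<close> stands for the block of
  length \<open>s + 1\<close> whose last digit is \<open>a < c (s + 1)\<close>.
\<close>

section \<open>Legal strings and intervals of integers\<close>

text \<open>Injections onto consecutive intervals glue to an injection onto their union. The pieces are
  disjoint because their images are, which is what makes sums over the union split.\<close>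

lemma stack_intervals:
  fixes f :: "'a \<Rightarrow> nat" and g :: "'a \<Rightarrow> 'b::comm_monoid_add"
  assumes "\<And>i. i < n \<Longrightarrow> finite (A i)"
    and "\<And>i. i < n \<Longrightarrow> bij_betw f (A i) {t i..<t (Suc i)}"
    and "\<And>i. i < n \<Longrightarrow> t i \<le> t (Suc i)"
  shows "bij_betw f (\<Union>i<n. A i) {t 0..<t n} \<and> sum g (\<Union>i<n. A i) = (\<Sum>i<n. sum g (A i)) \<and> t 0 \<le> t n"
  using assms
proof (induction n)
  case 0
  then show ?case by (simp add: bij_betw_def)
next
  case (Suc n)
  have IH: "bij_betw f (\<Union>i<n. A i) {t 0..<t n}" "sum g (\<Union>i<n. A i) = (\<Sum>i<n. sum g (A i))" "t 0 \<le> t n"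
    using Suc.IH Suc.prems by auto
  have b: "bij_betw f (A n) {t n..<t (Suc n)}" and le: "t n \<le> t (Suc n)"
    using Suc.prems by auto
  have disj: "{t 0..<t n} \<inter> {t n..<t (Suc n)} = {}" by auto
  have "bij_betw f ((\<Union>i<n. A i) \<union> A n) ({t 0..<t n} \<union> {t n..<t (Suc n)})"
    by (rule bij_betw_combine[OF IH(1) b disj])
  moreover have "{t 0..<t n} \<union> {t n..<t (Suc n)} = {t 0..<t (Suc n)}"
    using IH(3) le by auto
  moreover have "(\<Union>i<n. A i) \<inter> A n = {}"
    using disj bij_betw_imp_surj_on[OF IH(1)] bij_betw_imp_surj_on[OF b] by blast
  then have "sum g ((\<Union>i<n. A i) \<union> A n) = sum g (\<Union>i<n. A i) + sum g (A n)"
    using Suc.prems(1) by (intro sum.union_disjoint) auto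
  ultimately show ?case
    using IH le by (simp add: lessThan_Suc Un_commute add.commute)
qed

lemma decomposition_value_Nil [simp]: "decomposition_value H [] = 0"
  by (simp add: decomposition_value_def)

lemma decomposition_value_Cons [simp]:
  "decomposition_value H (x # xs) = x * H (Suc (length xs)) + decomposition_value H xs"
proof -
  have "decomposition_value H (x # xs) =
      (\<Sum>i=Suc 0..Suc (length xs). (x # xs) ! (i - 1) * H (length xs + 2 - i))"
    by (simp add: decomposition_value_def)
  also have "\<dots> = x * H (Suc (length xs)) +
      (\<Sum>i=Suc (Suc 0)..Suc (length xs). (x # xs) ! (i - 1) * H (length xs + 2 - i))"
    by (subst sum.atLeast_Suc_atMost) auto
  also have "(\<Sum>i=Suc (Suc 0)..Suc (length xs). (x # xs) ! (i - 1) * H (length xs + 2 - i)) =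
      (\<Sum>i=Suc 0..length xs. xs ! (i - 1) * H (length xs + 1 - i))"
    by (subst sum.shift_bounds_cl_Suc_ivl) (rule sum.cong, auto simp: nth_Cons')
  finally show ?thesis by (simp add: decomposition_value_def)
qed

lemma decomposition_value_replicate_0 [simp]:
  "decomposition_value H (replicate j 0 @ bs) = decomposition_value H bs"
  by (induction j) auto

lemma decomposition_value_lead:
  "decomposition_value H (map c [1..<Suc s] @ ys) =
     (\<Sum>i<s. c (Suc i) * H (length ys + s - i)) + decomposition_value H ys"
proof (induction s arbitrary: ys)
  case (Suc s)
  have "map c [1..<Suc (Suc s)] @ ys = map c [1..<Suc s] @ (c (Suc s) # ys)" by simp
  then show ?case by (simp only: Suc.IH) simp
qed simp

locale plrs =
  fixes L :: nat and c H :: "nat \<Rightarrow> nat"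
  assumes plrs: "positive_linear_recurrence L c H"
begin

lemma L_pos: "0 < L" and c1_pos: "0 < c (Suc 0)" and cL_pos: "0 < c L"
  and L1: "L = 1 \<Longrightarrow> 1 < c 1" and H1: "H (Suc 0) = 1" and H_pos: "0 < n \<Longrightarrow> 0 < H n"
  using plrs by (auto simp: positive_linear_recurrence_def)

text \<open>The value contributed by the digits \<open>c\<^sub>1, \<dots>, c\<^sub>s\<close> at the front of a string of length \<open>m\<close>.\<close>

definition greedy_prefix :: "nat \<Rightarrow> nat \<Rightarrow> nat"
  where "greedy_prefix m s = (\<Sum>i<s. c (Suc i) * H (m - i))"

text \<open>Both cases of the recurrence in one: the extra 1 for \<open>m < L\<close> is the room for the one
  incomplete string \<open>c\<^sub>1, \<dots>, c\<^sub>m\<close>.\<close>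

lemma H_rec: "H (Suc m) = greedy_prefix m (min L m) + (if m < L then 1 else 0)"
proof (cases "m = 0")
  case True
  then show ?thesis using L_pos H1 by (simp add: greedy_prefix_def)
next
  case False
  have *: "(\<Sum>i=1..k. c i * H (m + 1 - i)) = greedy_prefix m k" for k
    unfolding greedy_prefix_def by (rule sum.reindex_bij_witness[of _ Suc "\<lambda>i. i - 1"]) auto
  show ?thesis
  proof (cases "m < L")
    case True
    then have "H (m + 1) = (\<Sum>i=1..m. c i * H (m + 1 - i)) + 1"
      using plrs False by (auto simp: positive_linear_recurrence_def)
    with True * show ?thesis by (simp add: min_def)
  next
    case False
    then have "H (m + 1) = (\<Sum>i=1..L. c i * H (m + 1 - i))"
      using plrs by (auto simp: positive_linear_recurrence_def)
    with False * show ?thesis by (simp add: min_def)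
  qed
qed

lemma legal_cases:
  assumes "legal L c as"
  obtains "as = []"
  | "length as < L" "as = map c [1..<Suc (length as)]"
  | s a l bs where "s < L" "a < c (Suc s)" "legal L c bs"
      "as = map c [1..<Suc s] @ a # replicate l 0 @ bs"
  using assms
proof (cases rule: legal.cases)
  case legal_initial
  have "as = map c [1..<Suc (length as)]"
  proof (intro nth_equalityI)
    fix i assume "i < length as"
    moreover from this have "as ! (Suc i - 1) = c (Suc i)"
      using legal_initial by (metis atLeastAtMost_iff Suc_leI le_add1 plus_1_eq_Suc)
    ultimately show "as ! i = map c [1..<Suc (length as)] ! i" by (simp del: upt_Suc)
  qed (simp del: upt_Suc)
  then show ?thesis using that legal_initial by blast
next
  case (legal_block s l)
  obtain s' where s: "s = Suc s'" using legal_block by (cases s) auto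
  have 1: "take s' as = map c [1..<Suc s']"
  proof (intro nth_equalityI)
    fix i assume "i < length (take s' as)"
    then have "i < s'" by simp
    then have "Suc i \<in> {1..<s}" using s by auto
    then have "as ! (Suc i - 1) = c (Suc i)" using legal_block by blast
    with \<open>i < s'\<close> show "take s' as ! i = map c [1..<Suc s'] ! i" by (simp del: upt_Suc)
  qed (use legal_block s in auto)
  have 2: "take l (drop s as) = replicate l 0"
  proof (intro nth_equalityI)
    fix i assume "i < length (take l (drop s as))"
    then have "i < l" by simp
    then have "s + Suc i \<in> {s+1..s+l}" by auto
    then have "as ! (s + Suc i - 1) = 0" using legal_block by blast
    with \<open>i < l\<close> show "take l (drop s as) ! i = replicate l 0 ! i"
      using legal_block by simp
  qed (use legal_block s in auto)
  have "as = take s' as @ as ! s' # drop s as"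
    using legal_block s by (simp add: id_take_nth_drop)
  also have "drop s as = take l (drop s as) @ drop (s + l) as"
    by (metis add.commute append_take_drop_id drop_drop)
  finally have "as = map c [1..<Suc s'] @ as ! s' # replicate l 0 @ drop (s + l) as"
    unfolding 1 2 .
  then show ?thesis
    using that(3)[of s' "as ! s'" "drop (s + l) as" l] legal_block s by (simp del: upt_Suc)
next
  case legal_empty
  then show ?thesis by (rule that(1))
qed

lemma legal_blockI:
  assumes "s < L" "a < c (Suc s)" "legal L c bs"
    and as: "as = map c [1..<Suc s] @ a # replicate l 0 @ bs" and "as ! 0 > 0"
  shows "legal L c as"
proof (rule legal_block[where s = "Suc s" and l = l])
  show "\<forall>i\<in>{1..<Suc s}. as ! (i - 1) = c i"
    unfolding as by (auto simp: nth_append simp del: upt_Suc)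
  show "as ! (Suc s - 1) < c (Suc s)"
    using assms(2) unfolding as by (auto simp: nth_append simp del: upt_Suc)
  show "\<forall>i\<in>{Suc s + 1..Suc s + l}. as ! (i - 1) = 0"
    unfolding as by (auto simp: nth_append nth_Cons' simp del: upt_Suc)
  show "legal L c (drop (Suc s + l) as)"
    using assms(3) unfolding as by (simp del: upt_Suc)
  show "as \<noteq> []" "0 < as ! 0" "Suc s \<in> {1..L}" "Suc s + l \<le> length as"
    using assms(1,5) unfolding as by (simp_all del: upt_Suc)
qed

text \<open>Legal strings with leading zeros permitted. Removing the first block of such a string leaves
  another one, whereas removing it from a legal string may expose zeros; so the recursion runs
  on padded strings and legal ones are recovered by a difference.\<close>

definition padded :: "nat \<Rightarrow> nat list set"
  where "padded m = {as. length as = m \<and> (\<exists>j bs. as = replicate j 0 @ bs \<and> legal L c bs)}"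

definition prepend :: "nat \<Rightarrow> nat \<Rightarrow> nat list \<Rightarrow> nat list"
  where "prepend s a bs = map c [1..<Suc s] @ a # bs"

lemma prepend_0: "prepend 0 a bs = a # bs"
  by (simp add: prepend_def)

lemma length_prepend [simp]: "length (prepend s a bs) = Suc (s + length bs)"
  by (simp add: prepend_def)

lemma inj_prepend: "inj (prepend s a)"
  by (auto simp: prepend_def inj_on_def)

text \<open>Zeros in front of the remaining string are absorbed by the \<open>l\<close> in the definition of
  legality. Only a block that starts with 0 needs care: since \<open>c\<^sub>1 > 0\<close> it consists of the
  single digit 0, which merely lengthens the padding.\<close>

lemma prepend_padded:
  assumes "s < L" "a < c (Suc s)" "bs \<in> padded m"
  shows "prepend s a bs \<in> padded (Suc (s + m))"
proof -
  obtain j cs where bs: "bs = replicate j 0 @ cs" "legal L c cs" "length bs = m"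
    using assms(3) unfolding padded_def by blast
  show ?thesis
  proof (cases "prepend s a bs ! 0 > 0")
    case True
    have "legal L c (prepend s a bs)"
      by (rule legal_blockI[OF assms(1,2) bs(2) _ True, of j]) (simp only: prepend_def bs(1))
    then show ?thesis using bs(3) by (auto simp: padded_def intro!: exI[of _ "0::nat"])
  next
    case False
    have "s = 0"
    proof (rule ccontr)
      assume "s \<noteq> 0"
      then have "prepend s a bs ! 0 = c (Suc 0)"
        by (simp add: prepend_def nth_append del: upt_Suc)
      with False c1_pos show False by simp
    qed
    then have "prepend s a bs = replicate (Suc j) 0 @ cs"
      using False bs by (simp add: prepend_0)
    moreover have "length (prepend s a bs) = Suc (s + m)" using bs(3) by simp
    ultimately show ?thesis using bs(2) unfolding padded_def by blast
  qed
qed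

lemma padded_cases:
  assumes "as \<in> padded m"
  obtains "m < L" "as = map c [1..<Suc m]"
  | s a bs where "s < min L m" "a < c (Suc s)" "bs \<in> padded (m - Suc s)" "as = prepend s a bs"
proof -
  obtain j bs where as: "as = replicate j 0 @ bs" "legal L c bs" "length as = m"
    using assms unfolding padded_def by blast
  show ?thesis
  proof (cases j)
    case (Suc k)
    have "replicate k 0 @ bs \<in> padded (m - Suc 0)" "0 < min L m"
      using as Suc L_pos by (auto simp: padded_def)
    moreover have "as = prepend 0 0 (replicate k 0 @ bs)" using as Suc by (simp add: prepend_0)
    ultimately show ?thesis using that(2) c1_pos by blast
  next
    case 0
    then have "legal L c as" using as by simp
    then show ?thesis
    proof (cases rule: legal_cases)
      case 1
      then show ?thesis using that(1) as(3) L_pos by simp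
    next
      case 2
      then show ?thesis using that(1) as(3) by simp
    next
      case (3 s a l cs)
      have "m = Suc (s + length (replicate l 0 @ cs))" using 3 as(3) by (simp del: upt_Suc)
      moreover have "as = prepend s a (replicate l 0 @ cs)" using 3 by (simp add: prepend_def)
      ultimately show ?thesis using that(2)[of s a "replicate l 0 @ cs"] 3 by (auto simp: padded_def)
    qed
  qed
qed

lemma top_padded: "m < L \<Longrightarrow> map c [1..<Suc m] \<in> padded m"
proof (cases "m = 0")
  case True
  then show ?thesis by (auto simp: padded_def intro: legal_empty)
next
  case False
  assume "m < L"
  have "legal L c (map c [1..<Suc m])"
    using \<open>m < L\<close> False c1_pos by (intro legal_initial) (auto simp del: upt_Suc)
  then show ?thesis by (auto simp: padded_def intro!: exI[of _ "0::nat"])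
qed

lemma padded_eq:
  "padded m = (\<Union>s<min L m. \<Union>a<c (Suc s). prepend s a ` padded (m - Suc s))
      \<union> (if m < L then {map c [1..<Suc m]} else {})" (is "_ = ?R")
proof (intro equalityI subsetI)
  fix as assume "as \<in> padded m"
  then show "as \<in> ?R"
    by (cases rule: padded_cases) (auto simp del: upt_Suc)
next
  fix as assume "as \<in> ?R"
  then consider s a bs where "s < min L m" "a < c (Suc s)" "bs \<in> padded (m - Suc s)" "as = prepend s a bs"
    | "m < L" "as = map c [1..<Suc m]"
    by (fastforce split: if_splits simp del: upt_Suc)
  then show "as \<in> padded m"
  proof cases
    case 1
    then show ?thesis using prepend_padded[of s a bs "m - Suc s"] by simp
  qed (use top_padded in simp)
qed

lemma value_prepend:
  assumes "length bs = m - Suc s" "s < m"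
  shows "decomposition_value H (prepend s a bs) =
    greedy_prefix m s + a * H (m - s) + decomposition_value H bs"
  using assms unfolding prepend_def decomposition_value_lead greedy_prefix_def
  by (auto simp: Suc_diff_Suc intro!: sum.cong)

text \<open>The greedy algorithm as a tiling. For fixed \<open>s\<close>, increasing the last digit \<open>a\<close> of the first
  block moves the values up by \<open>H (m - s)\<close>, exactly the number of padded strings that can
  follow; at \<open>a = c (s + 1)\<close> the blocks with the next \<open>s\<close> take over. By the recurrence for
  \<open>H\<close> the last interval ends at \<open>H (m + 1)\<close>, with one point left for the incomplete string if
  \<open>m < L\<close>. The identity for sums over padded strings comes with the tiling.\<close>

lemma padded_tiling:
  fixes g :: "nat list \<Rightarrow> 'b::comm_monoid_add"
  shows "finite (padded m) \<and> bij_betw (decomposition_value H) (padded m) {..<H (Suc m)} \<and>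
    sum g (padded m) = (\<Sum>s<min L m. \<Sum>a<c (Suc s). \<Sum>bs\<in>padded (m - Suc s). g (prepend s a bs))
       + (if m < L then g (map c [1..<Suc m]) else 0)"
proof (induction m rule: less_induct)
  case (less m)
  define B where "B s a = prepend s a ` padded (m - Suc s)" for s a
  define C where "C s = (\<Union>a<c (Suc s). B s a)" for s
  define D where "D = (\<Union>s<min L m. C s)"
  define T where "T = (if m < L then {map c [1..<Suc m]} else {})"
  have fin: "finite (B s a)" if "s < min L m" for s a
    using less that by (auto simp: B_def)
  have bijB: "bij_betw (decomposition_value H) (B s a)
      {greedy_prefix m s + a * H (m - s)..<greedy_prefix m s + Suc a * H (m - s)}" if "s < min L m" for s a
  proof -
    let ?v = "decomposition_value H"
    have IH: "bij_betw ?v (padded (m - Suc s)) {..<H (m - s)}"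
      using less[of "m - Suc s"] that by (simp add: Suc_diff_Suc)
    have v: "?v (prepend s a bs) = greedy_prefix m s + a * H (m - s) + ?v bs" if "bs \<in> padded (m - Suc s)" for bs
      using that \<open>s < min L m\<close> by (intro value_prepend) (auto simp: padded_def)
    have "inj_on ?v (B s a)"
      using IH by (auto simp: B_def inj_on_def bij_betw_def v)
    moreover have "?v ` B s a = (\<lambda>x. x + (greedy_prefix m s + a * H (m - s))) ` (?v ` padded (m - Suc s))"
      unfolding B_def image_image by (rule image_cong) (auto simp: v)
    moreover have "\<dots> = {greedy_prefix m s + a * H (m - s)..<greedy_prefix m s + Suc a * H (m - s)}"
      using IH by (simp add: bij_betw_def lessThan_atLeast0 add_ac)
    ultimately show ?thesis by (simp add: bij_betw_def)
  qed
  have sumB: "sum g (B s a) = (\<Sum>bs\<in>padded (m - Suc s). g (prepend s a bs))" for s a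
    unfolding B_def by (subst sum.reindex) (auto intro: inj_on_subset[OF inj_prepend])
  have C: "bij_betw (decomposition_value H) (C s) {greedy_prefix m s..<greedy_prefix m (Suc s)}"
      "sum g (C s) = (\<Sum>a<c (Suc s). sum g (B s a))" "finite (C s)" if "s < min L m" for s
    using stack_intervals[of "c (Suc s)" "B s" "decomposition_value H" "\<lambda>a. greedy_prefix m s + a * H (m - s)" g]
      fin bijB that by (auto simp: C_def greedy_prefix_def)
  have D: "bij_betw (decomposition_value H) D {0..<greedy_prefix m (min L m)}"
      "sum g D = (\<Sum>s<min L m. sum g (C s))" "finite D"
    using stack_intervals[of "min L m" C "decomposition_value H" "greedy_prefix m" g] C
    by (auto simp: D_def greedy_prefix_def)
  have T: "bij_betw (decomposition_value H) T {greedy_prefix m (min L m)..<H (Suc m)}"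
  proof -
    have "decomposition_value H (map c [1..<Suc m]) = greedy_prefix m m"
      using decomposition_value_lead[of H c m "[]"] by (simp add: greedy_prefix_def del: upt_Suc)
    then show ?thesis
      by (auto simp: T_def H_rec[of m] bij_betw_def min_def)
  qed
  have disj: "{0..<greedy_prefix m (min L m)} \<inter> {greedy_prefix m (min L m)..<H (Suc m)} = {}" by auto
  have eq: "padded m = D \<union> T"
    unfolding D_def C_def B_def T_def by (rule padded_eq)
  have DT: "D \<inter> T = {}"
    using disj bij_betw_imp_surj_on[OF D(1)] bij_betw_imp_surj_on[OF T] by blast
  have "{0..<greedy_prefix m (min L m)} \<union> {greedy_prefix m (min L m)..<H (Suc m)} = {..<H (Suc m)}"
    by (auto simp: H_rec[of m])
  then have "bij_betw (decomposition_value H) (padded m) {..<H (Suc m)}"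
    using bij_betw_combine[OF D(1) T disj] eq by simp
  moreover have "sum g (padded m) = sum g D + sum g T"
    unfolding eq using D(3) DT by (intro sum.union_disjoint) (auto simp: T_def)
  moreover have "sum g T = (if m < L then g (map c [1..<Suc m]) else 0)"
    by (simp add: T_def del: upt_Suc)
  ultimately show ?case
    using D C(2) by (auto simp: eq sumB T_def simp del: upt_Suc)
qed

definition legal_strings :: "nat \<Rightarrow> nat list set"
  where "legal_strings m = {as. length as = m \<and> legal L c as}"

lemma legal_nth_0_pos: "legal L c as \<Longrightarrow> as \<noteq> [] \<Longrightarrow> 0 < as ! 0"
  by (cases rule: legal.cases) auto

lemma legal_strings_eq: "legal_strings (Suc m) = padded (Suc m) - Cons 0 ` padded m"
proof (intro equalityI subsetI)
  fix as assume as: "as \<in> legal_strings (Suc m)"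
  then have "as = replicate 0 0 @ as" "legal L c as" "length as = Suc m"
    by (auto simp: legal_strings_def)
  then have "as \<in> padded (Suc m)" unfolding padded_def by blast
  moreover have "as \<notin> Cons 0 ` padded m"
    using as legal_nth_0_pos[of as] by (auto simp: legal_strings_def)
  ultimately show "as \<in> padded (Suc m) - Cons 0 ` padded m" by simp
next
  fix as assume as: "as \<in> padded (Suc m) - Cons 0 ` padded m"
  then obtain j bs where j: "as = replicate j 0 @ bs" "legal L c bs" "length as = Suc m"
    unfolding padded_def by blast
  have "j = 0"
  proof (rule ccontr)
    assume "j \<noteq> 0"
    then obtain k where "j = Suc k" by (cases j) auto
    then have "as = 0 # replicate k 0 @ bs" "replicate k 0 @ bs \<in> padded m"
      using j by (auto simp: padded_def)
    then show False using as by blast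
  qed
  then show "as \<in> legal_strings (Suc m)" using j by (simp add: legal_strings_def)
qed

lemma Cons_0_padded: "Cons 0 ` padded m \<subseteq> padded (Suc m)"
  using prepend_padded[of 0 0 _ m] L_pos c1_pos by (auto simp: prepend_0)

lemma finite_padded: "finite (padded m)"
  and bij_padded: "bij_betw (decomposition_value H) (padded m) {..<H (Suc m)}"
  using padded_tiling[of m "\<lambda>_. 0::nat"] by auto

lemma bij_legal_strings:
  "bij_betw (decomposition_value H) (legal_strings (Suc m)) {H (Suc m)..<H (Suc (Suc m))}"
proof -
  let ?v = "decomposition_value H"
  have inj: "inj_on ?v (padded (Suc m))" and im: "?v ` padded (Suc m) = {..<H (Suc (Suc m))}"
    using bij_padded[of "Suc m"] by (auto simp: bij_betw_def)
  have "?v ` (Cons 0 ` padded m) = ?v ` padded m" by (simp add: image_image)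
  also have "\<dots> = {..<H (Suc m)}" using bij_padded[of m] by (simp add: bij_betw_def)
  finally have "?v ` legal_strings (Suc m) = {..<H (Suc (Suc m))} - {..<H (Suc m)}"
    using inj_on_image_set_diff[OF inj _ Cons_0_padded] im unfolding legal_strings_eq by auto
  also have "\<dots> = {H (Suc m)..<H (Suc (Suc m))}" by auto
  finally show ?thesis
    using inj by (auto simp: bij_betw_def legal_strings_eq intro: inj_on_subset)
qed

lemma H_less_Suc: "H (Suc m) < H (Suc (Suc m))"
proof -
  have le: "(\<Sum>i\<in>I. c (Suc i) * H (Suc m - i)) \<le> greedy_prefix (Suc m) k" if "I \<subseteq> {..<k}" for I k
    unfolding greedy_prefix_def using that by (intro sum_mono2) auto
  have c1: "H (Suc m) \<le> c (Suc 0) * H (Suc m)" using c1_pos by simp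
  consider "Suc m < L" | "L = 1" | "L \<le> Suc m" "L > 1" using L_pos by linarith
  then show ?thesis
  proof cases
    case 1
    then show ?thesis
      using order_trans[OF c1 le[of "{0}" "Suc m", simplified]] H_rec[of "Suc m"]
      by (simp add: min_def)
  next
    case 2
    have "H (Suc m) < c (Suc 0) * H (Suc m)" using 2 L1 H_pos[of "Suc m"] by simp
    also have "\<dots> \<le> greedy_prefix (Suc m) 1" using le[of "{0}" 1] by simp
    finally show ?thesis using H_rec[of "Suc m"] 2 by (simp add: min_def)
  next
    case 3
    have "H (Suc m) < H (Suc m) + c L * H (Suc m - (L - 1))" using 3 cL_pos H_pos by simp
    also have "\<dots> \<le> c (Suc 0) * H (Suc m) + c L * H (Suc m - (L - 1))"
      using c1 by (rule add_right_mono)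
    also have "\<dots> \<le> greedy_prefix (Suc m) L"
      using le[of "{0, L - 1}" L] 3 by simp
    finally show ?thesis using H_rec[of "Suc m"] 3 by (simp add: min_def)
  qed
qed

text \<open>The length is determined by the interval \<open>[H m, H (m + 1))\<close> that contains the value; for equal
  lengths the tiling is injective. This is what makes the definite description in
  \<open>legal_decomposition\<close> meaningful.\<close>

lemma legal_unique:
  assumes "legal L c as" "legal L c bs" "as \<noteq> []"
    and "decomposition_value H as = decomposition_value H bs"
  shows "as = bs"
proof -
  have interval: "decomposition_value H xs \<in> {H (Suc m)..<H (Suc (Suc m))}"
    if "legal L c xs" "length xs = Suc m" for xs m
    using bij_betwE[OF bij_legal_strings[of m]] that by (auto simp: legal_strings_def)
  obtain m where m: "length as = Suc m" using assms(3) by (cases as) auto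
  have "bs \<noteq> []"
  proof
    assume "bs = []"
    then show False using interval[OF assms(1) m] assms(4) H_pos[of "Suc m"] by simp
  qed
  then obtain k where k: "length bs = Suc k" by (cases bs) auto
  have mono: "H (Suc i) \<le> H (Suc j)" if "i \<le> j" for i j
    using lift_Suc_mono_le[of "\<lambda>n. H (Suc n)" i j] H_less_Suc that by (simp add: less_imp_le)
  have "m = k"
  proof (rule ccontr)
    assume "m \<noteq> k"
    then consider "Suc m \<le> k" | "Suc k \<le> m" by linarith
    then show False
      using mono[of "Suc m" k] mono[of "Suc k" m] interval[OF assms(1) m] interval[OF assms(2) k] assms(4)
      by cases auto
  qed
  then show ?thesis
    using bij_legal_strings[of m] assms m k by (auto simp: bij_betw_def inj_on_def legal_strings_def)
qed

lemma num_summands_value: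
  assumes "as \<in> legal_strings (Suc m)"
  shows "num_summands L c H (decomposition_value H as) = sum_list as"
proof -
  have as: "legal L c as" "as \<noteq> []" using assms by (auto simp: legal_strings_def)
  have "legal_decomposition L c H (decomposition_value H as) = as"
    unfolding legal_decomposition_def
    by (rule the_equality) (use as legal_unique in \<open>auto dest: sym\<close>)
  then show ?thesis by (simp add: num_summands_def)
qed

lemma sum_num_summands:
  "(\<Sum>N\<in>{H (Suc m)..<H (Suc (Suc m))}. g (num_summands L c H N)) = (\<Sum>as\<in>legal_strings (Suc m). g (sum_list as))"
  by (subst sum.reindex_bij_betw[OF bij_legal_strings, symmetric]) (auto simp: num_summands_value intro!: sum.cong)


section \<open>Generating functions of the number of summands\<close>

definition gen_padded :: "complex \<Rightarrow> nat \<Rightarrow> complex"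
  where "gen_padded z m = (\<Sum>as\<in>padded m. exp (z * of_nat (sum_list as)))"

text \<open>Shifted by one: the strings have length \<open>m + 1\<close>, so that the recurrence below holds from
  \<open>m = L\<close> on and the initial values are those for \<open>m < L\<close>.\<close>

definition gen_legal :: "complex \<Rightarrow> nat \<Rightarrow> complex"
  where "gen_legal z m = (\<Sum>as\<in>legal_strings (Suc m). exp (z * of_nat (sum_list as)))"

definition summands :: "nat \<Rightarrow> nat \<Rightarrow> nat"
  where "summands s a = (\<Sum>i<s. c (Suc i)) + a"

definition gen_block :: "complex \<Rightarrow> nat \<Rightarrow> complex"
  where "gen_block z s = (\<Sum>a<c (Suc s). exp (z * of_nat (summands s a)))"

lemma sum_list_prepend: "sum_list (prepend s a bs) = summands s a + sum_list bs"
proof -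
  have "sum_list (map c [1..<Suc s]) = (\<Sum>i<s. c (Suc i))"
    by (induction s) auto
  then show ?thesis by (simp add: prepend_def summands_def del: upt_Suc)
qed

lemma gen_padded_rec:
  assumes "L \<le> m"
  shows "gen_padded z m = (\<Sum>s<L. gen_block z s * gen_padded z (m - Suc s))"
proof -
  have "gen_padded z m = (\<Sum>s<L. \<Sum>a<c (Suc s). \<Sum>bs\<in>padded (m - Suc s). 
      exp (z * of_nat (sum_list (prepend s a bs))))"
    using padded_tiling[of m "\<lambda>as. exp (z * of_nat (sum_list as))"] assms
    by (simp add: gen_padded_def min_def)
  also have "\<dots> = (\<Sum>s<L. gen_block z s * gen_padded z (m - Suc s))"
    by (simp add: gen_padded_def gen_block_def sum_list_prepend sum_product distrib_left exp_add)
  finally show ?thesis .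
qed

lemma gen_legal_eq: "gen_legal z m = gen_padded z (Suc m) - gen_padded z m"
proof -
  have "gen_legal z m = gen_padded z (Suc m) - (\<Sum>as\<in>Cons 0 ` padded m. exp (z * of_nat (sum_list as)))"
    unfolding gen_legal_def gen_padded_def legal_strings_eq
    by (rule sum_diff[OF finite_padded Cons_0_padded])
  then show ?thesis by (simp add: gen_padded_def sum.reindex)
qed

text \<open>For padded strings the incomplete block disturbs the recurrence only below \<open>L\<close>; being a
  difference of consecutive terms, the generating function of legal strings inherits it.\<close>

lemma gen_legal_rec:
  assumes "L \<le> m"
  shows "gen_legal z m = (\<Sum>s<L. gen_block z s * gen_legal z (m - Suc s))"
  using gen_padded_rec[of m z] gen_padded_rec[of "Suc m" z] assms
  by (simp add: gen_legal_eq sum_subtractf right_diff_distrib Suc_diff_Suc)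

lemma gen_legal_0: "gen_legal 0 m = of_nat (card (legal_strings (Suc m)))"
  by (simp add: gen_legal_def)

lemma card_legal_strings: "card (legal_strings (Suc m)) = H (Suc (Suc m)) - H (Suc m)"
  using bij_betw_same_card[OF bij_legal_strings[of m]] by simp

end

section \<open>Perturbed renewal recurrences\<close>

text \<open>Within \<open>L\<close> steps every term of a new window acquires weight at least \<open>w 0 ^ L\<close> on one common
  term, the last one \<open>u (k + L - 1)\<close> of the old window: step by step, a term keeps the share
  \<open>w 0\<close> of the weight of its predecessor. Moving the centre towards this common term therefore
  shrinks the radius by the factor \<open>1 - w 0 ^ L\<close>. A centre and a radius replace the maximum
  and minimum of the real case because the terms are complex.\<close>

lemma window_contraction:
  fixes w :: "nat \<Rightarrow> real" and u :: "nat \<Rightarrow> complex"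
  assumes w: "\<And>s. s < L \<Longrightarrow> 0 \<le> w s" "(\<Sum>s<L. w s) = 1" and L: "0 < L"
    and e: "0 \<le> e"
    and near: "\<And>i. L \<le> i \<Longrightarrow> i < K \<Longrightarrow> norm (u i - (\<Sum>s<L. w s * u (i - Suc s))) \<le> e"
    and win: "\<And>i. k \<le> i \<Longrightarrow> i < k + L \<Longrightarrow> norm (u i - z) \<le> r"
    and K: "k + 2 * L \<le> K"
  shows "\<exists>z'. \<forall>i. k + L \<le> i \<longrightarrow> i < k + 2 * L \<longrightarrow> norm (u i - z') \<le> (1 - w 0 ^ L) * r + L * e"
proof -
  define v where "v = u (k + L - 1) - z"
  have r: "0 \<le> r" using win[of k] L by (meson le_add1 less_add_same_cancel1 norm_ge_zero order_refl order_trans)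
  have w0: "0 \<le> w 0" "w 0 \<le> 1"
    using w(1)[of 0] L member_le_sum[of 0 "{..<L}" w] w by auto
  have nv: "norm v \<le> r" using win[of "k + L - 1"] L by (simp add: v_def)
  \<comment> \<open>The number \<open>\<alpha>\<close> is the weight on the common term; the remaining weight \<open>1 - \<alpha>\<close> sits
    on terms of the old window, which are within \<open>r\<close> of \<open>z\<close>.\<close>
  have main: "\<exists>\<alpha>. w 0 ^ j \<le> \<alpha> \<and> \<alpha> \<le> 1 \<and> norm (u (k + L - 1 + j) - z - of_real \<alpha> * v) \<le> (1 - \<alpha>) * r + j * e"
    if "j \<le> L" for j
    using that
  proof (induction j rule: less_induct)
    case (less j)
    show ?case
    proof (cases j)
      case 0
      then show ?thesis by (intro exI[of _ 1]) (simp add: v_def)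
    next
      case (Suc j')
      define i where "i = k + L - 1 + j"
      have i: "i = k + L + j'" using Suc L by (simp add: i_def)
      have iK: "L \<le> i" "i < K" using i Suc less.prems K by auto
      have "\<exists>\<alpha>\<ge>0. \<alpha> \<le> 1 \<and> (s = 0 \<longrightarrow> w 0 ^ j' \<le> \<alpha>) \<and>
          norm (u (i - Suc s) - z - of_real \<alpha> * v) \<le> (1 - \<alpha>) * r + j' * e" if s: "s < L" for s
      proof (cases "s \<le> j'")
        case True
        define j'' where "j'' = j' - s"
        have "i - Suc s = k + L - 1 + j''" using True i L by (simp add: j''_def)
        moreover have "j'' < j" "j'' \<le> L" using Suc less.prems by (auto simp: j''_def)
        ultimately obtain \<alpha> where \<alpha>: "w 0 ^ j'' \<le> \<alpha>" "\<alpha> \<le> 1"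
          "norm (u (i - Suc s) - z - of_real \<alpha> * v) \<le> (1 - \<alpha>) * r + j'' * e"
          using less.IH[of j''] by auto
        have "real j'' * e \<le> real j' * e" using e by (intro mult_right_mono) (auto simp: j''_def)
        moreover have "0 \<le> \<alpha>" using \<alpha>(1) zero_le_power[OF w0(1), of j''] by linarith
        ultimately show ?thesis using \<alpha> by (intro exI[of _ \<alpha>]) (auto simp: j''_def)
      next
        case False
        then have "k \<le> i - Suc s" "i - Suc s < k + L" using i s by auto
        then have "norm (u (i - Suc s) - z) \<le> r" by (rule win)
        then show ?thesis using False e by (intro exI[of _ 0]) (auto intro: add_increasing2)
      qed
      then obtain \<alpha> where \<alpha>: "\<And>s. s < L \<Longrightarrow> 0 \<le> \<alpha> s" "\<And>s. s < L \<Longrightarrow> \<alpha> s \<le> 1" "w 0 ^ j' \<le> \<alpha> 0"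
        "\<And>s. s < L \<Longrightarrow> norm (u (i - Suc s) - z - of_real (\<alpha> s) * v) \<le> (1 - \<alpha> s) * r + j' * e"
        using L by metis
      define A where "A = (\<Sum>s<L. w s * \<alpha> s)"
      have A0: "w 0 ^ j \<le> A"
      proof -
        have "w 0 ^ j \<le> w 0 * \<alpha> 0" using \<alpha>(3) w0 Suc by (simp add: mult_left_mono)
        also have "\<dots> \<le> A" unfolding A_def
          using L w \<alpha> by (intro member_le_sum) auto
        finally show ?thesis .
      qed
      have A1: "A \<le> 1"
      proof -
        have "A \<le> (\<Sum>s<L. w s * 1)" unfolding A_def
          using w \<alpha> by (intro sum_mono mult_left_mono) auto
        then show ?thesis using w by simp
      qed
      have sw: "(\<Sum>s<L. of_real (w s) :: complex) = 1"
        using w(2) by (metis of_real_1 of_real_sum)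
      have "(\<Sum>s<L. w s * u (i - Suc s)) - z - of_real A * v
          = (\<Sum>s<L. w s * (u (i - Suc s) - z - of_real (\<alpha> s) * v))"
        by (simp add: right_diff_distrib sum_subtractf A_def sum_distrib_right[symmetric] sw mult.assoc[symmetric])
      also have "norm \<dots> \<le> (\<Sum>s<L. w s * ((1 - \<alpha> s) * r + j' * e))"
        using w \<alpha> by (intro sum_norm_le) (auto simp: norm_mult intro: mult_left_mono)
      also have "\<dots> = (\<Sum>s<L. w s) * (r + j' * e) - A * r"
        unfolding A_def sum_distrib_right sum_subtractf[symmetric] by (intro sum.cong) (auto simp: algebra_simps)
      finally have 1: "norm ((\<Sum>s<L. w s * u (i - Suc s)) - z - of_real A * v) \<le> (1 - A) * r + j' * e"
        using w by (simp add: algebra_simps)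
      have "u i - z - of_real A * v = (u i - (\<Sum>s<L. w s * u (i - Suc s))) + ((\<Sum>s<L. w s * u (i - Suc s)) - z - of_real A * v)"
        by simp
      also have "norm \<dots> \<le> e + ((1 - A) * r + j' * e)"
        by (rule norm_triangle_mono[OF near[OF iK] 1])
      also have "\<dots> = (1 - A) * r + j * e" using Suc by (simp add: algebra_simps)
      finally show ?thesis using A0 A1 by (auto simp: i_def)
    qed
  qed
  define \<delta> where "\<delta> = w 0 ^ L"
  show ?thesis
  proof (intro exI[of _ "z + of_real \<delta> * v"] allI impI)
    fix i assume i: "k + L \<le> i" "i < k + 2 * L"
    define j where "j = i + 1 - (k + L)"
    have j: "j \<le> L" "i = k + L - 1 + j" using i L by (auto simp: j_def)
    obtain \<alpha> where \<alpha>: "w 0 ^ j \<le> \<alpha>" "\<alpha> \<le> 1" "norm (u i - z - of_real \<alpha> * v) \<le> (1 - \<alpha>) * r + j * e"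
      using main[OF j(1)] j(2) by auto
    have \<delta>: "\<delta> \<le> \<alpha>" using \<alpha>(1) power_decreasing[OF j(1) w0] by (simp add: \<delta>_def)
    have "u i - (z + of_real \<delta> * v) = (u i - z - of_real \<alpha> * v) + of_real (\<alpha> - \<delta>) * v"
      by (simp add: algebra_simps)
    also have "norm \<dots> \<le> ((1 - \<alpha>) * r + j * e) + (\<alpha> - \<delta>) * r"
      using \<delta> nv by (intro norm_triangle_mono \<alpha>(3)) (simp add: norm_mult mult_left_mono del: of_real_diff)
    also have "\<dots> \<le> (1 - \<delta>) * r + L * e"
      using j(1) e by (auto simp: algebra_simps intro: mult_left_mono)
    finally show "norm (u i - (z + of_real \<delta> * v)) \<le> (1 - w 0 ^ L) * r + L * e" by (simp add: \<delta>_def)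
  qed
qed

lemma windows_contract:
  fixes w :: "nat \<Rightarrow> real" and u :: "nat \<Rightarrow> complex"
  assumes w: "\<And>s. s < L \<Longrightarrow> 0 \<le> w s" "(\<Sum>s<L. w s) = 1" and L: "0 < L"
    and e: "0 \<le> e"
    and near: "\<And>i. L \<le> i \<Longrightarrow> i < K \<Longrightarrow> norm (u i - (\<Sum>s<L. w s * u (i - Suc s))) \<le> e"
    and bdd: "\<And>i. i < K \<Longrightarrow> norm (u i) \<le> M"
    and K: "(Suc q) * L \<le> K"
  shows "\<exists>z. \<forall>i. K - L \<le> i \<longrightarrow> i < K \<longrightarrow> norm (u i - z) \<le> (1 - w 0 ^ L) ^ q * M + q * L * e"
proof -
  have w0: "0 \<le> w 0" "w 0 \<le> 1"
    using w(1)[of 0] L member_le_sum[of 0 "{..<L}" w] w by auto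
  define \<gamma> where "\<gamma> = 1 - w 0 ^ L"
  have \<gamma>: "0 \<le> \<gamma>" "\<gamma> \<le> 1" using w0 power_le_one[OF w0] by (auto simp: \<gamma>_def)
  define k where "k p = K - (Suc q) * L + p * L" for p
  have "\<exists>z. \<forall>i. k p \<le> i \<longrightarrow> i < k p + L \<longrightarrow> norm (u i - z) \<le> \<gamma> ^ p * M + p * L * e"
    if "p \<le> q" for p
    using that
  proof (induction p)
    case 0
    have "k 0 + L \<le> K" using K by (simp add: k_def)
    then show ?case using bdd by (intro exI[of _ 0]) auto
  next
    case (Suc p)
    then obtain z where z: "\<And>i. k p \<le> i \<Longrightarrow> i < k p + L \<Longrightarrow> norm (u i - z) \<le> \<gamma> ^ p * M + p * L * e"
      by auto
    have "(p + 2) * L \<le> Suc q * L" using Suc.prems by (intro mult_right_mono) auto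
    then have "k p + 2 * L \<le> K" using K by (simp add: k_def algebra_simps)
    then obtain z' where z': "\<And>i. k p + L \<le> i \<Longrightarrow> i < k p + 2 * L \<Longrightarrow>
        norm (u i - z') \<le> \<gamma> * (\<gamma> ^ p * M + p * L * e) + L * e"
      using window_contraction[of L w e K u "k p" z "\<gamma> ^ p * M + p * L * e"] w L e near z
      unfolding \<gamma>_def by blast
    have "\<gamma> * (\<gamma> ^ p * M + p * L * e) + L * e \<le> \<gamma> ^ Suc p * M + Suc p * L * e"
      using \<gamma> e mult_right_mono[of \<gamma> 1 "p * L * e"] by (simp add: algebra_simps)
    moreover have "k (Suc p) = k p + L" by (simp add: k_def)
    ultimately show ?case using z' by (intro exI[of _ z']) (fastforce simp: algebra_simps)
  qed
  from this[of q] obtain z where z: "\<And>i. k q \<le> i \<Longrightarrow> i < k q + L \<Longrightarrow> norm (u i - z) \<le> \<gamma> ^ q * M + q * L * e"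
    by auto
  have "k q = K - L" "k q + L = K" using K by (auto simp: k_def)
  then show ?thesis using z unfolding \<gamma>_def by (intro exI[of _ z]) auto
qed


text \<open>A triangular version of the renewal theorem for recurrences of finite order. In row \<open>n\<close> the
  weights \<open>v n\<close> approximate a probability distribution \<open>w\<close>, and the term of index \<open>n\<close> of that
  row is wanted. The growth hypothesis keeps the row bounded up to index \<open>n\<close>. With
  \<open>h j = \<Sum>\<^sub>s\<^sub>\<ge>\<^sub>j v s\<close> the sum \<open>V k = \<Sum>\<^sub>j h j * u (k - j)\<close> changes in each step by the
  defect \<open>\<Sum> v - 1\<close> times a bounded term, hence by \<open>o(1)\<close> in \<open>n\<close> steps. The last window is
  nearly constant by contraction, so \<open>u n n\<close> is nearly \<open>V n / \<Sum> h\<close>, and \<open>V\<close> may be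
  evaluated at the initial window. The limit depends only on \<open>w\<close> and the limiting initial
  values.\<close>

lemma perturbed_renewal_limit:
  fixes w :: "nat \<Rightarrow> real" and v u :: "nat \<Rightarrow> nat \<Rightarrow> complex" and a :: "nat \<Rightarrow> complex"
  assumes L: "0 < L"
    and w: "\<And>s. s < L \<Longrightarrow> 0 \<le> w s" "(\<Sum>s<L. w s) = 1" "0 < w 0"
    and v: "\<And>s. s < L \<Longrightarrow> (\<lambda>n. v n s) \<longlonglongrightarrow> of_real (w s)"
    and growth: "eventually (\<lambda>n. (\<Sum>s<L. norm (v n s)) \<le> 1 + C / real n) sequentially"
    and defect: "(\<lambda>n. real n * norm ((\<Sum>s<L. v n s) - 1)) \<longlonglongrightarrow> 0"
    and recur: "\<And>n k. L \<le> k \<Longrightarrow> u n k = (\<Sum>s<L. v n s * u n (k - Suc s))"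
    and init: "\<And>j. j < L \<Longrightarrow> (\<lambda>n. u n j) \<longlonglongrightarrow> a j"
  shows "(\<lambda>n. u n n) \<longlonglongrightarrow>
    (\<Sum>j<L. of_real (\<Sum>s\<in>{j..<L}. w s) * a (L - 1 - j)) / of_real (\<Sum>j<L. \<Sum>s\<in>{j..<L}. w s)"
proof -
  define D where "D = \<bar>C\<bar>"
  define M0 where "M0 = (\<Sum>j<L. SUP n. norm (u n j))"
  have bddj: "bdd_above (range (\<lambda>n. norm (u n j)))" if "j < L" for j
  proof -
    have "Bseq (\<lambda>n. u n j)" using convergent_imp_Bseq[OF convergentI[OF init]] that by blast
    then obtain B where "\<And>n. norm (u n j) \<le> B" by (auto simp: Bseq_def)
    then show ?thesis by (intro bdd_aboveI[of _ B]) auto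
  qed
  have SUP0: "0 \<le> (SUP n. norm (u n j))" if "j < L" for j
    using cSUP_upper2[OF bddj[OF that], of 0 0] by simp
  have M0: "norm (u n j) \<le> M0" if "j < L" for n j
  proof -
    have "norm (u n j) \<le> (SUP n. norm (u n j))"
      using bddj[OF that] by (rule cSUP_upper[rotated]) simp
    also have "\<dots> \<le> M0" unfolding M0_def
      using that SUP0 by (intro member_le_sum) auto
    finally show ?thesis .
  qed
  have M0pos: "0 \<le> M0" using M0[of 0 0] L norm_ge_zero order_trans by blast
  define M where "M = M0 * exp D"
  have good: "eventually (\<lambda>n. \<forall>k\<le>n. norm (u n k) \<le> M) sequentially"
    using growth eventually_gt_at_top[of 0]
  proof eventually_elim
    case (elim n)
    define \<beta> where "\<beta> = 1 + D / n"
    have \<beta>: "1 \<le> \<beta>" by (simp add: \<beta>_def D_def)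
    have sum\<beta>: "(\<Sum>s<L. norm (v n s)) \<le> \<beta>"
      using elim(1) divide_right_mono[OF abs_ge_self[of C], of "real n"] by (simp add: \<beta>_def D_def)
    have *: "norm (u n k) \<le> M0 * \<beta> ^ k" for k
    proof (induction k rule: less_induct)
      case (less k)
      show ?case
      proof (cases "k < L")
        case True
        then show ?thesis
          using M0[OF True, of n] \<beta> M0pos mult_left_mono[of 1 "\<beta> ^ k" M0] by (simp add: one_le_power)
      next
        case False
        have "norm (u n k) \<le> (\<Sum>s<L. norm (v n s) * (M0 * \<beta> ^ (k - 1)))"
          unfolding recur[OF False[unfolded not_less]]
        proof (intro sum_norm_le)
          fix s assume "s \<in> {..<L}"
          then have "norm (u n (k - Suc s)) \<le> M0 * \<beta> ^ (k - Suc s)" using False by (intro less) auto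
          also have "\<dots> \<le> M0 * \<beta> ^ (k - 1)"
            using \<beta> M0pos by (intro mult_left_mono power_increasing) auto
          finally show "norm (v n s * u n (k - Suc s)) \<le> norm (v n s) * (M0 * \<beta> ^ (k - 1))"
            by (simp add: norm_mult mult_left_mono)
        qed
        also have "\<dots> \<le> \<beta> * (M0 * \<beta> ^ (k - 1))"
          unfolding sum_distrib_right[symmetric] using sum\<beta> \<beta> M0pos by (intro mult_right_mono) auto
        also have "\<dots> = M0 * \<beta> ^ k" using False L by (cases k) auto
        finally show ?thesis .
      qed
    qed
    have "\<beta> ^ n \<le> exp D"
      using exp_ge_one_plus_x_over_n_power_n[of n D] elim(2) by (simp add: \<beta>_def D_def)
    then have "M0 * \<beta> ^ k \<le> M" if "k \<le> n" for k
      using that \<beta> M0pos power_increasing[OF that \<beta>] unfolding M_def by (intro mult_left_mono) auto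
    then show ?case using * order_trans by blast
  qed
  have Mpos: "0 \<le> M" using M0pos by (simp add: M_def)
  define e where "e n = (\<Sum>s<L. norm (v n s - of_real (w s))) * M" for n
  have e0: "0 \<le> e n" for n using Mpos by (simp add: e_def sum_nonneg)
  have e_lim: "e \<longlonglongrightarrow> 0"
  proof -
    have "(\<lambda>n. (\<Sum>s<L. norm (v n s - of_real (w s))) * M) \<longlonglongrightarrow> (\<Sum>s<L. norm (of_real (w s) - of_real (w s) :: complex)) * M"
      by (intro tendsto_intros v) auto
    then show ?thesis by (simp add: e_def[abs_def])
  qed
  define \<gamma> where "\<gamma> = 1 - w 0 ^ L"
  have w01: "w 0 \<le> 1" using L member_le_sum[of 0 "{..<L}" w] w by auto
  have \<gamma>: "0 \<le> \<gamma>" "\<gamma> < 1" using w(3) w01 by (auto simp: \<gamma>_def power_le_one)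
  have osc: "eventually (\<lambda>n. \<exists>z. \<forall>i. Suc n - L \<le> i \<longrightarrow> i < Suc n \<longrightarrow> norm (u n i - z) \<le> \<eta>) sequentially"
    if \<eta>: "0 < \<eta>" for \<eta>
  proof -
    have "(\<lambda>q. \<gamma> ^ q * M) \<longlonglongrightarrow> 0 * M" using \<gamma> by (intro tendsto_intros LIMSEQ_realpow_zero) auto
    then have "eventually (\<lambda>q. \<gamma> ^ q * M < \<eta> / 2) sequentially" using \<eta> by (intro order_tendstoD) auto
    \<comment> \<open>The number \<open>q\<close> of contractions is fixed before \<open>n\<close> grows, so that the errors
      \<open>e n\<close> of the last \<open>(q + 1) * L\<close> steps vanish in the limit.\<close>
    then obtain q where q: "\<gamma> ^ q * M < \<eta> / 2" by (auto simp: eventually_sequentially)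
    have "(\<lambda>n. q * L * e n) \<longlonglongrightarrow> real (q * L) * 0" by (intro tendsto_intros e_lim)
    then have "eventually (\<lambda>n. q * L * e n < \<eta> / 2) sequentially" using \<eta> by (intro order_tendstoD) auto
    with good eventually_ge_at_top[of "Suc q * L"] show ?thesis
    proof eventually_elim
      case (elim n)
      have near: "norm (u n i - (\<Sum>s<L. w s * u n (i - Suc s))) \<le> e n" if "L \<le> i" "i < Suc n" for i
      proof -
        have "u n i - (\<Sum>s<L. w s * u n (i - Suc s)) = (\<Sum>s<L. (v n s - w s) * u n (i - Suc s))"
          unfolding recur[OF that(1)] sum_subtractf[symmetric] by (simp add: left_diff_distrib)
        also have "norm \<dots> \<le> (\<Sum>s<L. norm (v n s - of_real (w s)) * M)"
          using elim(1) that by (intro sum_norm_le) (auto simp: norm_mult intro!: mult_left_mono)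
        finally show ?thesis by (simp add: e_def sum_distrib_right)
      qed
      have "\<exists>z. \<forall>i. Suc n - L \<le> i \<longrightarrow> i < Suc n \<longrightarrow> norm (u n i - z) \<le> (1 - w 0 ^ L) ^ q * M + q * L * e n"
        using windows_contract[of L w "e n" "Suc n" "u n" M q] w L e0 near elim by simp
      moreover have "(1 - w 0 ^ L) ^ q * M + q * L * e n \<le> \<eta>" using q elim(3) by (simp add: \<gamma>_def)
      ultimately show ?case using order_trans by blast
    qed
  qed
  have osc0: "(\<lambda>n. u n n - u n (n - j)) \<longlonglongrightarrow> 0" if j: "j < L" for j
  proof (rule LIMSEQ_I)
    fix r :: real assume "0 < r"
    then have "eventually (\<lambda>n. \<exists>z. \<forall>i. Suc n - L \<le> i \<longrightarrow> i < Suc n \<longrightarrow> norm (u n i - z) \<le> r / 3) sequentially"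
      by (intro osc) simp
    then have "eventually (\<lambda>n. norm (u n n - u n (n - j) - 0) < r) sequentially"
    proof eventually_elim
      case (elim n)
      then obtain z where z: "\<And>i. Suc n - L \<le> i \<Longrightarrow> i < Suc n \<Longrightarrow> norm (u n i - z) \<le> r / 3" by auto
      have "norm ((u n n - z) - (u n (n - j) - z)) \<le> r / 3 + r / 3"
        using j L by (intro norm_triangle_le_diff add_mono z) auto
      then show ?case using \<open>0 < r\<close> by simp
    qed
    then show "\<exists>no. \<forall>n\<ge>no. norm (u n n - u n (n - j) - 0) < r" by (simp add: eventually_sequentially)
  qed
  define h where "h n j = (\<Sum>s\<in>{j..<L}. v n s)" for n j
  define h' where "h' j = (\<Sum>s\<in>{j..<L}. w s)" for j
  have h: "(\<lambda>n. h n j) \<longlonglongrightarrow> of_real (h' j)" for j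
    unfolding h_def h'_def of_real_sum by (intro tendsto_sum v) auto
  define V where "V n k = (\<Sum>j<L. h n j * u n (k - j))" for n k
  have V_step: "V n (Suc k) - V n k = ((\<Sum>s<L. v n s) - 1) * u n (Suc k)" if k: "L \<le> Suc k" for n k
  proof -
    have hL: "h n L = 0" by (simp add: h_def)
    have hS: "h n j - h n (Suc j) = v n j" if "j < L" for j
      unfolding h_def using that by (simp add: sum.atLeast_Suc_lessThan)
    have "V n (Suc k) = (\<Sum>j<Suc L. h n j * u n (Suc k - j))"
      by (simp add: V_def hL)
    also have "\<dots> = h n 0 * u n (Suc k) + (\<Sum>j<L. h n (Suc j) * u n (k - j))"
      by (subst sum.lessThan_Suc_shift) simp
    finally have "V n (Suc k) - V n k = h n 0 * u n (Suc k) - (\<Sum>j<L. (h n j - h n (Suc j)) * u n (k - j))"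
      by (simp add: V_def sum_subtractf left_diff_distrib)
    also have "(\<Sum>j<L. (h n j - h n (Suc j)) * u n (k - j)) = u n (Suc k)"
      unfolding recur[OF k] by (intro sum.cong) (auto simp: hS)
    also have "h n 0 = (\<Sum>s<L. v n s)" by (simp add: h_def lessThan_atLeast0)
    finally show ?thesis by (simp add: left_diff_distrib)
  qed
  have V_drift: "(\<lambda>n. V n n - V n (L - 1)) \<longlonglongrightarrow> 0"
  proof (rule Lim_null_comparison)
    show "(\<lambda>n. real n * norm ((\<Sum>s<L. v n s) - 1) * M) \<longlonglongrightarrow> 0"
      using tendsto_mult_right[OF defect, of M] by simp
    show "eventually (\<lambda>n. norm (V n n - V n (L - 1)) \<le> real n * norm ((\<Sum>s<L. v n s) - 1) * M) sequentially"
      using good eventually_ge_at_top[of L]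
    proof eventually_elim
      case (elim n)
      have "norm (V n (L - 1 + k) - V n (L - 1)) \<le> k * (norm ((\<Sum>s<L. v n s) - 1) * M)" if "L - 1 + k \<le> n" for k
        using that
      proof (induction k)
        case (Suc k)
        have "V n (L - 1 + Suc k) - V n (L - 1) = (V n (Suc (L - 1 + k)) - V n (L - 1 + k)) + (V n (L - 1 + k) - V n (L - 1))"
          by simp
        also have "norm \<dots> \<le> norm ((\<Sum>s<L. v n s) - 1) * M + k * (norm ((\<Sum>s<L. v n s) - 1) * M)"
        proof (rule norm_triangle_mono)
          show "norm (V n (Suc (L - 1 + k)) - V n (L - 1 + k)) \<le> norm ((\<Sum>s<L. v n s) - 1) * M"
            using elim Suc.prems by (subst V_step) (auto simp: norm_mult intro!: mult_left_mono)
          show "norm (V n (L - 1 + k) - V n (L - 1)) \<le> k * (norm ((\<Sum>s<L. v n s) - 1) * M)"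
            using Suc by simp
        qed
        also have "\<dots> = Suc k * (norm ((\<Sum>s<L. v n s) - 1) * M)" by (simp add: algebra_simps)
        finally show ?case .
      qed simp
      from this[of "n - (L - 1)"]
      have "norm (V n n - V n (L - 1)) \<le> real (n - (L - 1)) * (norm ((\<Sum>s<L. v n s) - 1) * M)"
        using elim(2) L by simp
      also have "\<dots> \<le> real n * (norm ((\<Sum>s<L. v n s) - 1) * M)"
        using Mpos by (intro mult_right_mono) auto
      finally show ?case by (simp add: mult.assoc)
    qed
  qed
  have "(\<lambda>n. V n (L - 1)) \<longlonglongrightarrow> (\<Sum>j<L. of_real (h' j) * a (L - 1 - j))"
    unfolding V_def using L by (intro tendsto_intros h init) auto
  from tendsto_add[OF V_drift this]
  have V_lim: "(\<lambda>n. V n n) \<longlonglongrightarrow> (\<Sum>j<L. of_real (h' j) * a (L - 1 - j))" by simp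
  have "(\<lambda>n. \<Sum>j<L. h n j * (u n n - u n (n - j))) \<longlonglongrightarrow> (\<Sum>j<L. of_real (h' j) * 0)"
    by (intro tendsto_intros h osc0) auto
  from tendsto_add[OF this V_lim]
  have uh: "(\<lambda>n. u n n * (\<Sum>j<L. h n j)) \<longlonglongrightarrow> (\<Sum>j<L. of_real (h' j) * a (L - 1 - j))"
    by (simp add: V_def right_diff_distrib sum_subtractf sum_distrib_left mult.commute)
  have S: "(\<lambda>n. \<Sum>j<L. h n j) \<longlonglongrightarrow> of_real (\<Sum>j<L. h' j)"
    unfolding of_real_sum by (intro tendsto_intros h)
  have h'0: "h' 0 = 1" using w(2) by (simp add: h'_def lessThan_atLeast0)
  have "h' 0 \<le> (\<Sum>j<L. h' j)"
    using L w(1) by (intro member_le_sum) (auto simp: h'_def intro!: sum_nonneg)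
  then have pos: "of_real (\<Sum>j<L. h' j) \<noteq> (0::complex)" using h'0 by (simp del: of_real_sum)
  have "(\<lambda>n. u n n * (\<Sum>j<L. h n j) / (\<Sum>j<L. h n j)) \<longlonglongrightarrow>
      (\<Sum>j<L. of_real (h' j) * a (L - 1 - j)) / of_real (\<Sum>j<L. h' j)"
    by (rule tendsto_divide[OF uh S pos])
  moreover have "eventually (\<lambda>n. u n n * (\<Sum>j<L. h n j) / (\<Sum>j<L. h n j) = u n n) sequentially"
    using tendsto_imp_eventually_ne[OF S pos] by eventually_elim simp
  ultimately have "(\<lambda>n. u n n) \<longlonglongrightarrow> (\<Sum>j<L. of_real (h' j) * a (L - 1 - j)) / of_real (\<Sum>j<L. h' j)"
    by (rule Lim_transform_eventually)
  then show ?thesis by (simp only: h'_def)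
qed

section \<open>Exponential tilting to third order\<close>

text \<open>For a centred random variable \<open>\<xi>\<close> and a second variable \<open>l\<close> with \<open>E \<xi>\<^sup>2 = 2 g E l\<close>, the terms
  of first and second order in \<open>E exp (z \<xi> - g l z\<^sup>2)\<close> cancel. Taking absolute values inside the
  expectation destroys only the second-order cancellation: the linear term \<open>Re z * E \<xi>\<close> still
  vanishes.\<close>

lemma tilted_sum_expansion:
  fixes p \<xi> l :: "'i \<Rightarrow> real" and g :: real
    and w :: "'i \<Rightarrow> complex \<Rightarrow> complex"
  assumes I: "finite I" and p: "\<And>i. i \<in> I \<Longrightarrow> 0 \<le> p i" "(\<Sum>i\<in>I. p i) = 1"
    and \<xi>: "(\<Sum>i\<in>I. p i * \<xi> i) = 0" "(\<Sum>i\<in>I. p i * (\<xi> i)\<^sup>2) = 2 * g * (\<Sum>i\<in>I. p i * l i)"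
  defines "w \<equiv> \<lambda>i z. z * of_real (\<xi> i) - of_real (l i * g) * z\<^sup>2"
  shows "\<exists>C\<ge>0. \<forall>z. norm z \<le> 1 \<longrightarrow>
    norm ((\<Sum>i\<in>I. p i * exp (w i z)) - 1) \<le> C * norm z ^ 3 \<and>
    (\<Sum>i\<in>I. p i * norm (exp (w i z))) \<le> 1 + C * (norm z)\<^sup>2"
proof -
  define D where "D i = \<bar>\<xi> i\<bar> + \<bar>l i * g\<bar>" for i
  define C3 where "C3 i = exp (D i) * D i ^ 3 / 2 + (\<bar>\<xi> i * (l i * g)\<bar> + (l i * g)\<^sup>2 / 2)" for i
  define C2 where "C2 i = \<bar>l i * g\<bar> + exp (D i) * (D i)\<^sup>2" for i
  have D0: "0 \<le> D i" for i by (simp add: D_def)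
  have C30: "0 \<le> C3 i" and C20: "0 \<le> C2 i" for i using D0[of i] by (auto simp: C3_def C2_def)
  have w: "norm (w i z) \<le> D i * norm z" if z: "norm z \<le> 1" for i z
  proof -
    have "norm (w i z) \<le> norm (z * \<xi> i) + norm (l i * g * z\<^sup>2)"
      unfolding w_def by (rule norm_triangle_ineq4)
    also have "\<dots> = \<bar>\<xi> i\<bar> * norm z + \<bar>l i * g\<bar> * (norm z * norm z)"
      by (simp add: norm_mult power2_eq_square abs_mult)
    also have "\<dots> \<le> \<bar>\<xi> i\<bar> * norm z + \<bar>l i * g\<bar> * (norm z * 1)"
      using z by (intro add_mono mult_left_mono) auto
    finally show ?thesis by (simp add: D_def algebra_simps)
  qed
  have w': "norm (w i z) \<le> D i" if "norm z \<le> 1" for i z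
    using w[OF that, of i] mult_left_mono[OF that D0[of i]] by simp
  have third: "norm (exp (w i z) - (1 + w i z + z\<^sup>2 * (\<xi> i)\<^sup>2 / 2)) \<le> C3 i * norm z ^ 3"
    if z: "norm z \<le> 1" for i z
  proof -
    have "norm (exp (w i z) - (\<Sum>k\<le>2. w i z ^ k / fact k)) \<le> exp (norm (w i z)) * norm (w i z) ^ Suc 2 / fact 2"
      by (rule Taylor_exp_field)
    also have "(\<Sum>k\<le>2. w i z ^ k / fact k) = 1 + w i z + (w i z)\<^sup>2 / 2"
      by (simp add: numeral_2_eq_2)
    also have "exp (norm (w i z)) * norm (w i z) ^ Suc 2 / fact 2 \<le> exp (D i) * (D i * norm z) ^ 3 / 2"
      using w[OF z, of i] w'[OF z, of i] D0[of i]
      by (auto simp: eval_nat_numeral intro!: mult_mono divide_right_mono)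
    finally have 1: "norm (exp (w i z) - (1 + w i z + (w i z)\<^sup>2 / 2)) \<le> exp (D i) * D i ^ 3 / 2 * norm z ^ 3"
      by (simp add: power_mult_distrib)
    have "(w i z)\<^sup>2 / 2 - z\<^sup>2 * (\<xi> i)\<^sup>2 / 2 = - (of_real (\<xi> i * (l i * g)) * z ^ 3) + of_real ((l i * g)\<^sup>2 / 2) * z ^ 4"
      by (simp add: w_def power2_eq_square field_simps eval_nat_numeral)
    also have "norm \<dots> \<le> norm (of_real (\<xi> i * (l i * g)) * z ^ 3) + norm (of_real ((l i * g)\<^sup>2 / 2) * z ^ 4)"
      by (metis norm_minus_cancel norm_triangle_ineq)
    also have "\<dots> = \<bar>\<xi> i * (l i * g)\<bar> * norm z ^ 3 + (l i * g)\<^sup>2 / 2 * norm z ^ 4"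
      unfolding norm_mult norm_power norm_of_real by simp
    also have "\<dots> \<le> \<bar>\<xi> i * (l i * g)\<bar> * norm z ^ 3 + (l i * g)\<^sup>2 / 2 * norm z ^ 3"
      using z by (intro add_mono mult_left_mono power_decreasing) auto
    finally have 2: "norm ((w i z)\<^sup>2 / 2 - z\<^sup>2 * (\<xi> i)\<^sup>2 / 2) \<le> (\<bar>\<xi> i * (l i * g)\<bar> + (l i * g)\<^sup>2 / 2) * norm z ^ 3"
      by (simp add: distrib_right)
    have "exp (w i z) - (1 + w i z + z\<^sup>2 * (\<xi> i)\<^sup>2 / 2) =
      (exp (w i z) - (1 + w i z + (w i z)\<^sup>2 / 2)) + ((w i z)\<^sup>2 / 2 - z\<^sup>2 * (\<xi> i)\<^sup>2 / 2)" by simp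
    also have "norm \<dots> \<le> exp (D i) * D i ^ 3 / 2 * norm z ^ 3 + (\<bar>\<xi> i * (l i * g)\<bar> + (l i * g)\<^sup>2 / 2) * norm z ^ 3"
      by (rule norm_triangle_mono[OF 1 2])
    finally show ?thesis by (simp add: C3_def distrib_right)
  qed
  have second: "norm (exp (w i z)) \<le> 1 + Re z * \<xi> i + C2 i * (norm z)\<^sup>2" if z: "norm z \<le> 1" for i z
  proof -
    define r where "r = Re (w i z)"
    have r: "\<bar>r\<bar> \<le> D i * norm z" "\<bar>r\<bar> \<le> D i"
      using abs_Re_le_cmod[of "w i z"] w[OF z, of i] w'[OF z, of i] by (auto simp: r_def)
    have "norm (exp r - (\<Sum>k\<le>1. r ^ k / fact k)) \<le> exp (norm r) * norm r ^ Suc 1 / fact 1"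
      by (rule Taylor_exp_field)
    also have "exp (norm r) * norm r ^ Suc 1 / fact 1 = exp \<bar>r\<bar> * \<bar>r\<bar> ^ 2" by (simp add: numeral_2_eq_2)
    also have "\<dots> \<le> exp (D i) * (D i * norm z) ^ 2"
      using r by (intro mult_mono power_mono) auto
    finally have 1: "exp r \<le> 1 + r + exp (D i) * (D i)\<^sup>2 * (norm z)\<^sup>2"
      by (simp add: power_mult_distrib)
    have 2: "r = Re z * \<xi> i - l i * g * Re (z\<^sup>2)"
      by (simp add: r_def w_def)
    have 3: "- (l i * g * Re (z\<^sup>2)) \<le> \<bar>l i * g\<bar> * (norm z)\<^sup>2"
    proof -
      have "- (l i * g * Re (z\<^sup>2)) \<le> \<bar>l i * g\<bar> * \<bar>Re (z\<^sup>2)\<bar>"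
        by (metis abs_ge_self abs_minus_cancel abs_mult)
      also have "\<dots> \<le> \<bar>l i * g\<bar> * (norm z)\<^sup>2"
        using abs_Re_le_cmod[of "z\<^sup>2"] by (intro mult_left_mono) (auto simp: norm_power)
      finally show ?thesis .
    qed
    have "exp r \<le> 1 + Re z * \<xi> i + (\<bar>l i * g\<bar> * (norm z)\<^sup>2 + exp (D i) * (D i)\<^sup>2 * (norm z)\<^sup>2)"
      using 1 2 3 by linarith
    then show ?thesis by (simp add: r_def C2_def distrib_right)
  qed
  define C where "C = max (\<Sum>i\<in>I. p i * C3 i) (\<Sum>i\<in>I. p i * C2 i)"
  have Cpos: "0 \<le> C" using p C20 by (auto simp: C_def le_max_iff_disj intro!: sum_nonneg)
  show ?thesis
  proof (intro exI[of _ C] conjI Cpos allI impI)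
    fix z :: complex assume z: "norm z \<le> 1"
    have p1: "(\<Sum>i\<in>I. of_real (p i)) = (1::complex)" using p(2) by (metis of_real_1 of_real_sum)
    have p2: "(\<Sum>i\<in>I. of_real (p i) * of_real (\<xi> i)) = (0::complex)"
      using arg_cong[OF \<xi>(1), of complex_of_real] by simp
    have p3: "(\<Sum>i\<in>I. of_real (p i) * (of_real (\<xi> i))\<^sup>2) = 2 * of_real g * (\<Sum>i\<in>I. of_real (p i) * of_real (l i) :: complex)"
      using arg_cong[OF \<xi>(2), of complex_of_real] by simp
    have "(\<Sum>i\<in>I. p i * (1 + w i z + z\<^sup>2 * (\<xi> i)\<^sup>2 / 2)) =
        (\<Sum>i\<in>I. of_real (p i)) + z * (\<Sum>i\<in>I. of_real (p i) * of_real (\<xi> i))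
        - g * z\<^sup>2 * (\<Sum>i\<in>I. of_real (p i) * of_real (l i))
        + z\<^sup>2 / 2 * (\<Sum>i\<in>I. of_real (p i) * (of_real (\<xi> i))\<^sup>2)"
      unfolding sum_distrib_left sum.distrib[symmetric] sum_subtractf[symmetric]
      by (intro sum.cong) (auto simp: w_def algebra_simps)
    also have "\<dots> = 1" unfolding p1 p2 p3 by simp
    finally have "(\<Sum>i\<in>I. p i * exp (w i z)) - 1
        = (\<Sum>i\<in>I. p i * (exp (w i z) - (1 + w i z + z\<^sup>2 * (\<xi> i)\<^sup>2 / 2)))"
      by (simp add: right_diff_distrib sum_subtractf)
    also have "norm \<dots> \<le> (\<Sum>i\<in>I. p i * (C3 i * norm z ^ 3))"
      using p(1) third[OF z] by (intro sum_norm_le) (simp add: norm_mult mult_left_mono)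
    also have "\<dots> = (\<Sum>i\<in>I. p i * C3 i) * norm z ^ 3"
      by (simp add: sum_distrib_right mult.assoc)
    also have "\<dots> \<le> C * norm z ^ 3" by (intro mult_right_mono) (auto simp: C_def)
    finally show "norm ((\<Sum>i\<in>I. p i * exp (w i z)) - 1) \<le> C * norm z ^ 3" .
    have "(\<Sum>i\<in>I. p i * norm (exp (w i z))) \<le> (\<Sum>i\<in>I. p i * (1 + Re z * \<xi> i + C2 i * (norm z)\<^sup>2))"
      using p(1) second[OF z] by (intro sum_mono mult_left_mono)
    also have "\<dots> = (\<Sum>i\<in>I. p i) + Re z * (\<Sum>i\<in>I. p i * \<xi> i) + (\<Sum>i\<in>I. p i * C2 i) * (norm z)\<^sup>2"
      unfolding sum_distrib_left sum_distrib_right sum.distrib[symmetric]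
      by (intro sum.cong) (auto simp: algebra_simps)
    also have "\<dots> \<le> 1 + C * (norm z)\<^sup>2"
      unfolding p(2) \<xi>(1) by (simp add: C_def mult_right_mono)
    finally show "(\<Sum>i\<in>I. p i * norm (exp (w i z))) \<le> 1 + C * (norm z)\<^sup>2" .
  qed
qed

section \<open>A central limit theorem from exponential transforms\<close>

text \<open>Extracts a limit from a Taylor expansion in \<open>t\<close> whose remainder, relative to the term sought,
  is of order \<open>t\<close>: let \<open>n\<close> tend to infinity first and \<open>t\<close> to 0 afterwards.\<close>

lemma tendsto_0_if_small_plus_null:
  fixes m :: "nat \<Rightarrow> real" and a :: "real \<Rightarrow> nat \<Rightarrow> real"
  assumes bound: "\<And>t n. 0 < t \<Longrightarrow> t \<le> 1 \<Longrightarrow> \<bar>m n\<bar> \<le> C * t + a t n"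
    and a: "\<And>t. 0 < t \<Longrightarrow> a t \<longlonglongrightarrow> 0"
  shows "m \<longlonglongrightarrow> 0"
proof (rule LIMSEQ_I)
  fix r :: real assume r: "0 < r"
  define t where "t = min 1 (r / (2 * (\<bar>C\<bar> + 1)))"
  have t: "0 < t" "t \<le> 1" using r by (auto simp: t_def)
  have "C * t \<le> \<bar>C\<bar> * (r / (2 * (\<bar>C\<bar> + 1)))"
    using r t by (intro mult_mono) (auto simp: t_def)
  also have "\<dots> \<le> r / 2" using r by (simp add: field_simps)
  finally have Ct: "C * t \<le> r / 2" .
  have "eventually (\<lambda>n. a t n < r / 2) sequentially" using a[OF t(1)] r by (intro order_tendstoD) auto
  then have "eventually (\<lambda>n. norm (m n - 0) < r) sequentially"
  proof eventually_elim
    case (elim n)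
    then show ?case using bound[OF t, of n] Ct by simp
  qed
  then show "\<exists>no. \<forall>n\<ge>no. norm (m n - 0) < r" by (simp add: eventually_sequentially)
qed

text \<open>Constant real \<open>\<zeta> = \<plusminus>1\<close> bounds exponential moments, hence \<open>E \<bar>X n\<bar>\<^sup>3\<close>; constant imaginary
  \<open>\<zeta>\<close> gives pointwise limits of characteristic functions. The third moment controls the
  Taylor remainder of the characteristic function uniformly in \<open>n\<close>, so its imaginary and real
  parts determine the limits of the first and second moments. Varying \<open>\<zeta>\<close> with \<open>n\<close> absorbs
  the change from the limiting variance \<open>v\<close> to the exact one.\<close>

lemma clt_from_exponential_transforms:
  fixes p :: "nat \<Rightarrow> 'a pmf" and X :: "nat \<Rightarrow> 'a \<Rightarrow> real" and v t :: real
  assumes fin: "\<And>n. finite (set_pmf (p n))" and v: "0 < v"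
    and transform: "\<And>\<zeta>::nat \<Rightarrow> complex. Bseq \<zeta> \<Longrightarrow>
      (\<lambda>n. measure_pmf.expectation (p n) (\<lambda>x. exp (\<zeta> n * X n x)) * exp (- (v / 2 * (\<zeta> n)\<^sup>2))) \<longlonglongrightarrow> 1"
  defines "m \<equiv> \<lambda>n. measure_pmf.expectation (p n) (X n)"
    and "V \<equiv> \<lambda>n. measure_pmf.variance (p n) (X n)"
  shows "m \<longlonglongrightarrow> 0" and "V \<longlonglongrightarrow> v"
    and "(\<lambda>n. measure_pmf.expectation (p n) (\<lambda>x. exp (\<i> * of_real (t * ((X n x - m n) / sqrt (V n)))))) \<longlonglongrightarrow> complex_of_real (exp (- (t\<^sup>2 / 2)))"
proof -
  have int [simp, intro]: "integrable (measure_pmf (p n)) f" for n and f :: "'a \<Rightarrow> 'b::{banach,second_countable_topology}"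
    by (rule integrable_measure_pmf_finite[OF fin])
  let ?E = "\<lambda>n f. measure_pmf.expectation (p n) f"
  have E_exp: "(\<lambda>n. measure_pmf.expectation (p n) (\<lambda>x. exp (\<zeta> n * X n x))) \<longlonglongrightarrow> exp (of_real (v / 2) * z\<^sup>2)"
    if "\<zeta> \<longlonglongrightarrow> z" for \<zeta> and z :: complex
  proof -
    have "Bseq \<zeta>" using that by (intro convergent_imp_Bseq convergentI)
    note transform[OF this]
    moreover have "(\<lambda>n. exp (v / 2 * (\<zeta> n)\<^sup>2)) \<longlonglongrightarrow> exp (v / 2 * z\<^sup>2)"
      by (intro tendsto_intros that)
    ultimately have "(\<lambda>n. measure_pmf.expectation (p n) (\<lambda>x. exp (\<zeta> n * X n x)) * exp (- (v / 2 * (\<zeta> n)\<^sup>2)) * exp (v / 2 * (\<zeta> n)\<^sup>2)) \<longlonglongrightarrow> 1 * exp (v / 2 * z\<^sup>2)"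
      by (rule tendsto_mult)
    then show ?thesis by (simp add: mult.assoc exp_add[symmetric])
  qed
  have Bexp: "Bseq (\<lambda>n. ?E n (\<lambda>x. exp (s * X n x)))" for s :: real
  proof -
    have "of_real (?E n (\<lambda>x. exp (s * X n x))) = measure_pmf.expectation (p n) (\<lambda>x. exp (complex_of_real s * X n x))" for n
      unfolding integral_complex_of_real[symmetric] by (simp add: exp_of_real[symmetric])
    then have "(\<lambda>n. complex_of_real (?E n (\<lambda>x. exp (s * X n x)))) \<longlonglongrightarrow> exp (of_real (v / 2) * (complex_of_real s)\<^sup>2)"
      using E_exp[of "\<lambda>_. of_real s" "of_real s"] by simp
    then have "Bseq (\<lambda>n. complex_of_real (?E n (\<lambda>x. exp (s * X n x))))"
      by (intro convergent_imp_Bseq convergentI)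
    then show ?thesis by (simp add: Bseq_def)
  qed
  obtain A where A: "\<And>n. ?E n (\<lambda>x. exp (X n x)) \<le> A" using Bexp[of 1] by (auto simp: Bseq_def)
  obtain B where B: "\<And>n. ?E n (\<lambda>x. exp (- X n x)) \<le> B" using Bexp[of "-1"] by (auto simp: Bseq_def)
  have cube: "\<bar>y\<bar> ^ 3 / 6 \<le> exp y + exp (- y)" for y :: real
  proof -
    have "(\<Sum>k\<in>{3}. \<bar>y\<bar> ^ k / fact k) \<le> (\<Sum>k. \<bar>y\<bar> ^ k / fact k)"
      using summable_exp[of "\<bar>y\<bar>"] by (intro sum_le_suminf) (auto simp: field_simps)
    then have "\<bar>y\<bar> ^ 3 / fact 3 \<le> exp \<bar>y\<bar>" by (simp add: exp_def divide_inverse mult.commute)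
    also have "\<dots> \<le> exp y + exp (- y)" by (cases "0 \<le> y") auto
    finally show ?thesis by (simp add: fact_numeral)
  qed
  define C where "C = A + B"
  have moment3: "?E n (\<lambda>x. \<bar>X n x\<bar> ^ 3 / 6) \<le> C" for n
  proof -
    have "?E n (\<lambda>x. \<bar>X n x\<bar> ^ 3 / 6) \<le> ?E n (\<lambda>x. exp (X n x) + exp (- X n x))"
      by (intro integral_mono int cube)
    also have "\<dots> \<le> C" using A[of n] B[of n] by (simp add: C_def)
    finally show ?thesis .
  qed
  define \<phi> where "\<phi> t n = measure_pmf.expectation (p n) (\<lambda>x. exp (\<i> * of_real (t * X n x)))" for t n
  have \<phi>_lim: "(\<lambda>n. \<phi> t n) \<longlonglongrightarrow> of_real (exp (- (v / 2 * t\<^sup>2)))" for t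
    using E_exp[of "\<lambda>_. \<i> * of_real t" "\<i> * of_real t"]
    by (simp add: \<phi>_def power_mult_distrib mult.assoc exp_of_real[symmetric])
  define q where "q n = ?E n (\<lambda>x. (X n x)\<^sup>2)" for n
  have taylor: "norm (\<phi> t n - (1 + \<i> * of_real (t * m n) - of_real (t\<^sup>2 / 2 * q n))) \<le> C * \<bar>t\<bar> ^ 3" for t n
  proof -
    have "1 + \<i> * of_real (t * m n) - of_real (t\<^sup>2 / 2 * q n) =
       measure_pmf.expectation (p n) (\<lambda>x. 1 + \<i> * of_real (t * X n x) - of_real (t\<^sup>2 / 2 * (X n x)\<^sup>2))"
      by (simp add: m_def q_def integral_complex_of_real flip: of_real_power)
    then have "\<phi> t n - (1 + \<i> * of_real (t * m n) - of_real (t\<^sup>2 / 2 * q n)) =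
       measure_pmf.expectation (p n) (\<lambda>x. exp (\<i> * of_real (t * X n x)) - (1 + \<i> * of_real (t * X n x) - of_real (t\<^sup>2 / 2 * (X n x)\<^sup>2)))"
      by (simp only: \<phi>_def Bochner_Integration.integral_diff int)
    also have "norm \<dots> \<le> ?E n (\<lambda>x. norm (exp (\<i> * of_real (t * X n x)) - (1 + \<i> * of_real (t * X n x) - of_real (t\<^sup>2 / 2 * (X n x)\<^sup>2))))"
      by (rule integral_norm_bound)
    also have "\<dots> \<le> ?E n (\<lambda>x. \<bar>t\<bar> ^ 3 * (\<bar>X n x\<bar> ^ 3 / 6))"
    proof (intro integral_mono int)
      fix x
      define y where "y = t * X n x"
      have "norm (exp (\<i> * of_real y) - (\<Sum>k\<le>2. (\<i> * y) ^ k / fact k)) \<le> \<bar>y\<bar> ^ Suc 2 / fact (Suc 2)"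
        by (rule iexp_approx1)
      also have "(\<Sum>k\<le>2. (\<i> * y) ^ k / fact k) = 1 + \<i> * of_real y - of_real (t\<^sup>2 / 2 * (X n x)\<^sup>2)"
        by (simp add: numeral_2_eq_2 y_def power_mult_distrib)
      also have "\<bar>y\<bar> ^ Suc 2 / fact (Suc 2) = \<bar>t\<bar> ^ 3 * (\<bar>X n x\<bar> ^ 3 / 6)"
        by (simp add: y_def abs_mult power_mult_distrib fact_numeral)
      finally show "norm (exp (\<i> * of_real (t * X n x)) - (1 + \<i> * of_real (t * X n x) - of_real (t\<^sup>2 / 2 * (X n x)\<^sup>2))) \<le> \<bar>t\<bar> ^ 3 * (\<bar>X n x\<bar> ^ 3 / 6)"
        unfolding y_def .
    qed
    also have "\<dots> = \<bar>t\<bar> ^ 3 * ?E n (\<lambda>x. \<bar>X n x\<bar> ^ 3 / 6)" by (rule integral_mult_right_zero)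
    also have "\<dots> \<le> \<bar>t\<bar> ^ 3 * C" by (intro mult_left_mono moment3) simp
    finally show ?thesis by (simp add: mult.commute)
  qed
  show m_lim: "m \<longlonglongrightarrow> 0"
  proof (rule tendsto_0_if_small_plus_null)
    fix t :: real and n assume t: "0 < t" "t \<le> 1"
    have C: "0 \<le> C" using order_trans[OF _ moment3[of 0]] by (simp add: integral_nonneg)
    have "\<bar>Im (\<phi> t n) - t * m n\<bar> \<le> C * t ^ 3"
      using abs_Im_le_cmod[of "\<phi> t n - (1 + \<i> * of_real (t * m n) - of_real (t\<^sup>2 / 2 * q n))"] taylor[of t n] t by simp
    then have "t * \<bar>m n\<bar> \<le> C * t ^ 3 + \<bar>Im (\<phi> t n)\<bar>"
      using t by (simp add: abs_mult[of t, symmetric, simplified])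
    then have "\<bar>m n\<bar> \<le> C * t\<^sup>2 + \<bar>Im (\<phi> t n)\<bar> / t"
      using t by (simp add: field_simps eval_nat_numeral)
    also have "C * t\<^sup>2 \<le> C * t" using C t by (intro mult_left_mono) (auto simp: power2_eq_square mult_left_le)
    finally show "\<bar>m n\<bar> \<le> C * t + \<bar>Im (\<phi> t n)\<bar> / t" by simp
  next
    fix t :: real assume "0 < t"
    have "(\<lambda>n. \<bar>Im (\<phi> t n)\<bar> / t) \<longlonglongrightarrow> \<bar>Im (of_real (exp (- (v / 2 * t\<^sup>2))))\<bar> / t"
      using \<open>0 < t\<close> by (intro tendsto_intros \<phi>_lim) auto
    then show "(\<lambda>n. \<bar>Im (\<phi> t n)\<bar> / t) \<longlonglongrightarrow> 0" by simp
  qed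
  have q_lim: "(\<lambda>n. q n - v) \<longlonglongrightarrow> 0"
  proof (rule tendsto_0_if_small_plus_null)
    fix t :: real and n assume t: "0 < t" "t \<le> 1"
    define y where "y = v / 2 * t\<^sup>2"
    have y: "0 \<le> y" using v by (simp add: y_def)
    have "norm (exp (- y) - (\<Sum>k\<le>1. (- y) ^ k / fact k)) \<le> exp (norm (- y)) * norm (- y) ^ Suc 1 / fact 1"
      by (rule Taylor_exp_field)
    also have "\<dots> \<le> exp (v / 2) * y\<^sup>2"
      using v t y by (auto simp: power2_eq_square y_def mult_le_one intro!: mult_mono)
    finally have 1: "\<bar>exp (- y) - 1 + y\<bar> \<le> exp (v / 2) * y\<^sup>2" by simp
    have 2: "\<bar>Re (\<phi> t n) - 1 + t\<^sup>2 / 2 * q n\<bar> \<le> C * t ^ 3"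
      using abs_Re_le_cmod[of "\<phi> t n - (1 + \<i> * of_real (t * m n) - of_real (t\<^sup>2 / 2 * q n))"] taylor[of t n] t by simp
    have "t\<^sup>2 / 2 * (q n - v) = (Re (\<phi> t n) - 1 + t\<^sup>2 / 2 * q n) - (exp (- y) - 1 + y) - (Re (\<phi> t n) - exp (- y))"
      by (simp add: y_def field_simps)
    then have "\<bar>t\<^sup>2 / 2 * (q n - v)\<bar> \<le> C * t ^ 3 + exp (v / 2) * y\<^sup>2 + \<bar>Re (\<phi> t n) - exp (- y)\<bar>"
      using 1 2 by linarith
    then have "t\<^sup>2 / 2 * \<bar>q n - v\<bar> \<le> C * t ^ 3 + exp (v / 2) * y\<^sup>2 + \<bar>Re (\<phi> t n) - exp (- y)\<bar>"
      by (simp add: abs_mult)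
    then have "\<bar>q n - v\<bar> \<le> (C * t ^ 3 + exp (v / 2) * y\<^sup>2 + \<bar>Re (\<phi> t n) - exp (- y)\<bar>) / (t\<^sup>2 / 2)"
      using t by (subst pos_le_divide_eq) (auto simp: mult.commute)
    also have "\<dots> = 2 * C * t + exp (v / 2) * v\<^sup>2 / 2 * t\<^sup>2 + 2 / t\<^sup>2 * \<bar>Re (\<phi> t n) - exp (- y)\<bar>"
      using t by (simp add: y_def field_simps eval_nat_numeral)
    also have "exp (v / 2) * v\<^sup>2 / 2 * t\<^sup>2 \<le> exp (v / 2) * v\<^sup>2 / 2 * t"
      using t by (intro mult_left_mono) (auto simp: power2_eq_square mult_left_le)
    finally show "\<bar>q n - v\<bar> \<le> (2 * C + exp (v / 2) * v\<^sup>2 / 2) * t + 2 / t\<^sup>2 * \<bar>Re (\<phi> t n) - exp (- (v / 2 * t\<^sup>2))\<bar>"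
      by (simp add: y_def distrib_right)
  next
    fix t :: real assume "0 < t"
    have "(\<lambda>n. 2 / t\<^sup>2 * \<bar>Re (\<phi> t n) - exp (- (v / 2 * t\<^sup>2))\<bar>) \<longlonglongrightarrow> 2 / t\<^sup>2 * \<bar>Re (of_real (exp (- (v / 2 * t\<^sup>2)))) - exp (- (v / 2 * t\<^sup>2))\<bar>"
      by (intro tendsto_intros \<phi>_lim)
    then show "(\<lambda>n. 2 / t\<^sup>2 * \<bar>Re (\<phi> t n) - exp (- (v / 2 * t\<^sup>2))\<bar>) \<longlonglongrightarrow> 0" by simp
  qed
  have V_eq: "V n = (q n - v) + v - (m n)\<^sup>2" for n
    unfolding V_def q_def m_def by (subst measure_pmf.variance_eq) auto
  have "(\<lambda>n. (q n - v) + v - (m n)\<^sup>2) \<longlonglongrightarrow> 0 + v - 0\<^sup>2"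
    by (intro tendsto_intros q_lim m_lim)
  then show V_lim: "V \<longlonglongrightarrow> v" by (simp add: V_eq[abs_def])
  \<comment> \<open>Standardizing \<open>X n\<close> evaluates its transform at the convergent sequence
    \<open>\<i> * \<theta> n\<close>; this is where \<open>\<zeta>\<close> has to depend on \<open>n\<close>.\<close>
  define \<theta> where "\<theta> n = t / sqrt (V n)" for n
  have \<theta>: "\<theta> \<longlonglongrightarrow> t / sqrt v" unfolding \<theta>_def using v by (intro tendsto_intros V_lim) auto
  have "(\<lambda>n. measure_pmf.expectation (p n) (\<lambda>x. exp (\<i> * of_real (\<theta> n) * X n x)) * exp (- (\<i> * of_real (\<theta> n * m n))))
     \<longlonglongrightarrow> exp (v / 2 * (\<i> * of_real (t / sqrt v))\<^sup>2) * exp (- (\<i> * of_real (t / sqrt v * 0)))"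
    by (intro tendsto_mult E_exp tendsto_intros \<theta> m_lim)
  moreover have "exp (v / 2 * (\<i> * of_real (t / sqrt v))\<^sup>2) * exp (- (\<i> * of_real (t / sqrt v * 0))) = of_real (exp (- (t\<^sup>2 / 2)))"
  proof -
    have "(\<i> * complex_of_real (t / sqrt v))\<^sup>2 = of_real (- (t\<^sup>2 / v))"
      using v by (simp add: power_mult_distrib power_divide flip: of_real_power)
    then show ?thesis using v by (simp add: mult.commute flip: exp_of_real)
  qed
  moreover have "measure_pmf.expectation (p n) (\<lambda>x. exp (\<i> * of_real (\<theta> n) * X n x)) * exp (- (\<i> * of_real (\<theta> n * m n))) =
      measure_pmf.expectation (p n) (\<lambda>x. exp (\<i> * of_real (t * ((X n x - m n) / sqrt (V n)))))" for n
    unfolding integral_mult_left_zero[symmetric] exp_add[symmetric]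
    by (intro integral_cong_AE AE_I2) (auto simp: \<theta>_def algebra_simps diff_divide_distrib)
  ultimately show "(\<lambda>n. measure_pmf.expectation (p n) (\<lambda>x. exp (\<i> * of_real (t * ((X n x - m n) / sqrt (V n)))))) \<longlonglongrightarrow> complex_of_real (exp (- (t\<^sup>2 / 2)))"
    by simp
qed

section \<open>The limit law for legal decompositions\<close>

context plrs
begin

lemma ex_rho: "\<exists>\<rho>::real. 0 < \<rho> \<and> (\<Sum>s<L. c (Suc s) * \<rho> ^ Suc s) = 1"
proof -
  define f where "f x = (\<Sum>s<L. c (Suc s) * x ^ Suc s)" for x :: real
  have "1 \<le> real (c (Suc 0))" using c1_pos by simp
  also have "\<dots> \<le> f 1" unfolding f_def
    using member_le_sum[of 0 "{..<L}" "\<lambda>s. real (c (Suc s))"] L_pos by simp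
  finally have f1: "1 \<le> f 1" .
  have "\<exists>x\<ge>0. x \<le> 1 \<and> f x = 1"
    by (rule IVT') (use f1 in \<open>auto simp: f_def intro!: continuous_intros\<close>)
  then obtain x where x: "0 \<le> x" "f x = 1" by auto
  then have "x \<noteq> 0" by (auto simp: f_def)
  with x show ?thesis unfolding f_def by (intro exI[of _ x]) auto
qed

definition rho :: real
  where "rho = (SOME \<rho>::real. 0 < \<rho> \<and> (\<Sum>s<L. c (Suc s) * \<rho> ^ Suc s) = 1)"

lemma rho_pos: "0 < rho" and rho_root: "(\<Sum>s<L. c (Suc s) * rho ^ Suc s) = 1"
  using someI_ex[OF ex_rho] by (auto simp: rho_def)

definition block_index :: "(nat \<times> nat) set"
  where "block_index = (SIGMA s:{..<L}. {..<c (Suc s)})"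

text \<open>The expectation over a random block, where each block of length \<open>s + 1\<close> has probability
  \<open>rho ^ (s + 1)\<close>; these sum to 1 by the choice of \<open>rho\<close>.\<close>

definition block_mean :: "(nat \<times> nat \<Rightarrow> real) \<Rightarrow> real"
  where "block_mean f = (\<Sum>b\<in>block_index. rho ^ Suc (fst b) * f b)"

definition block_len :: "nat \<times> nat \<Rightarrow> real" where "block_len b = Suc (fst b)"
definition block_summands :: "nat \<times> nat \<Rightarrow> real" where "block_summands b = summands (fst b) (snd b)"

text \<open>The constants \<open>\<mu>\<close> (\<open>drift\<close>) and \<open>\<sigma>\<^sup>2\<close> (\<open>spread\<close>) of the renewal-reward process with these blocks: reward per unit
  of length, and variance per unit of length of the reward after compensation by \<open>\<mu>\<close> times the
  length.\<close>

definition drift :: real where "drift = block_mean block_summands / block_mean block_len"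
definition excess :: "nat \<times> nat \<Rightarrow> real" where "excess b = block_summands b - drift * block_len b"
definition spread :: real where "spread = block_mean (\<lambda>b. (excess b)\<^sup>2) / block_mean block_len"

lemma finite_block_index: "finite block_index"
  by (simp add: block_index_def)

lemma sum_block_index: "(\<Sum>b\<in>block_index. f b) = (\<Sum>s<L. \<Sum>a<c (Suc s). f (s, a))"
  unfolding block_index_def by (subst sum.Sigma) auto

lemma block_mean_1: "block_mean (\<lambda>_. 1) = 1"
  using rho_root by (simp add: block_mean_def sum_block_index)

lemma block_mean_pos:
  assumes "b \<in> block_index" "0 < f b" "\<And>b. b \<in> block_index \<Longrightarrow> 0 \<le> f b"
  shows "0 < block_mean f"
  unfolding block_mean_def using assms rho_pos finite_block_index
  by (intro sum_pos2[of _ b]) auto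

lemma zero_block: "(0, 0) \<in> block_index"
  using L_pos c1_pos by (simp add: block_index_def)

lemma block_mean_block_len_pos: "0 < block_mean block_len"
  by (rule block_mean_pos[OF zero_block]) (auto simp: block_len_def)

text \<open>A block with a summand is the single digit 1 if \<open>L = 1\<close>, where \<open>c 1 > 1\<close>, and otherwise a
  block of full length \<open>L\<close>, which exists because \<open>c L > 0\<close> and starts with \<open>c 1 > 0\<close>.\<close>

lemma drift_pos: "0 < drift"
proof -
  obtain b where "b \<in> block_index" "0 < block_summands b"
  proof (cases "L = 1")
    case True
    have "(0, 1) \<in> block_index" "0 < block_summands (0, 1)"
      unfolding block_index_def block_summands_def summands_def using L1[OF True] L_pos by auto
    then show ?thesis by (rule that)
  next
    case False
    then have "0 \<in> {..<L - 1}" using L_pos by auto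
    then have "0 < (\<Sum>i<L - 1. c (Suc i))"
      using c1_pos by (intro sum_pos2[of _ 0]) auto
    then have "(L - 1, 0) \<in> block_index" "0 < block_summands (L - 1, 0)"
      using cL_pos L_pos by (auto simp: block_index_def block_summands_def summands_def simp flip: of_nat_sum)
    then show ?thesis by (rule that)
  qed
  then have "0 < block_mean block_summands" by (intro block_mean_pos[of b]) (auto simp: block_summands_def)
  then show ?thesis using block_mean_block_len_pos by (simp add: drift_def)
qed

text \<open>The excess is not identically 0, because the block consisting of one digit 0 has no summands
  although the average rate is positive.\<close>

lemma spread_pos: "0 < spread"
proof -
  have "excess (0, 0) = - drift" by (simp add: excess_def block_summands_def block_len_def summands_def)
  then have "0 < block_mean (\<lambda>b. (excess b)\<^sup>2)"
    using drift_pos by (intro block_mean_pos[OF zero_block]) auto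
  then show ?thesis using block_mean_block_len_pos by (simp add: spread_def)
qed

lemma block_mean_excess: "block_mean excess = 0"
proof -
  have "block_mean excess = block_mean block_summands - drift * block_mean block_len"
    by (simp add: block_mean_def excess_def right_diff_distrib sum_subtractf sum_distrib_left mult_ac)
  then show ?thesis using block_mean_block_len_pos by (simp add: drift_def)
qed

lemma block_mean_excess_sq: "block_mean (\<lambda>b. (excess b)\<^sup>2) = 2 * (spread / 2) * block_mean block_len"
  using block_mean_block_len_pos by (simp add: spread_def)

text \<open>The logarithm of the dominant root of the recurrence, relative to its value at \<open>z = 0\<close> and
  truncated after the second order.\<close>

definition cumulant :: "complex \<Rightarrow> complex"
  where "cumulant z = of_real drift * z + of_real (spread / 2) * z\<^sup>2"

text \<open>The coefficients of the recurrence after division by powers of \<open>exp (cumulant z) / rho\<close>. At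
  \<open>z = 0\<close> they are the probabilities of the block lengths.\<close>

definition tilted_weight :: "complex \<Rightarrow> nat \<Rightarrow> complex"
  where "tilted_weight z s = gen_block z s * of_real (rho ^ Suc s) * exp (- (of_nat (Suc s) * cumulant z))"

definition normalized_gen :: "complex \<Rightarrow> nat \<Rightarrow> complex"
  where "normalized_gen z k = gen_legal z k * of_real (rho ^ k) * exp (- (of_nat k * cumulant z))"

lemma normalized_gen_rec:
  assumes "L \<le> k"
  shows "normalized_gen z k = (\<Sum>s<L. tilted_weight z s * normalized_gen z (k - Suc s))"
proof -
  have "tilted_weight z s * normalized_gen z (k - Suc s) =
      gen_block z s * gen_legal z (k - Suc s) * of_real (rho ^ k) * exp (- (of_nat k * cumulant z))" if "s < L" for s
  proof -
    have k: "k = Suc s + (k - Suc s)" using that assms by simp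
    have "of_real (rho ^ k) = (of_real (rho ^ Suc s) * of_real (rho ^ (k - Suc s)) :: complex)"
      by (subst k) (simp only: power_add of_real_mult)
    moreover have "exp (- (of_nat k * cumulant z)) =
        exp (- (of_nat (Suc s) * cumulant z)) * exp (- (of_nat (k - Suc s) * cumulant z))"
      by (subst k) (simp only: of_nat_add distrib_right minus_add_distrib exp_add)
    ultimately show ?thesis by (simp add: tilted_weight_def normalized_gen_def mult_ac)
  qed
  then have "(\<Sum>s<L. tilted_weight z s * normalized_gen z (k - Suc s)) =
      (\<Sum>s<L. gen_block z s * gen_legal z (k - Suc s) * of_real (rho ^ k) * exp (- (of_nat k * cumulant z)))"
    by (intro sum.cong) auto
  then show ?thesis
    unfolding normalized_gen_def[of z k] gen_legal_rec[OF assms] sum_distrib_right by (rule sym)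
qed

lemma tilted_weight_eq:
  "tilted_weight z s = (\<Sum>a<c (Suc s). of_real (rho ^ Suc (fst (s, a))) *
     exp (z * of_real (excess (s, a)) - of_real (block_len (s, a) * (spread / 2)) * z\<^sup>2))"
proof -
  have "exp (z * of_nat (summands s a)) * exp (- (of_nat (Suc s) * cumulant z)) =
     exp (z * of_real (excess (s, a)) - of_real (block_len (s, a) * (spread / 2)) * z\<^sup>2)" for a
    unfolding exp_add[symmetric]
    by (rule arg_cong[of _ _ exp]) (simp add: excess_def block_summands_def block_len_def cumulant_def algebra_simps)
  then show ?thesis
    unfolding tilted_weight_def gen_block_def sum_distrib_right
    by (intro sum.cong) (auto simp: mult_ac)
qed

lemma tilted_weight_expansion:
  "\<exists>C\<ge>0. \<forall>z. norm z \<le> 1 \<longrightarrow>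
    norm ((\<Sum>s<L. tilted_weight z s) - 1) \<le> C * norm z ^ 3 \<and>
    (\<Sum>s<L. norm (tilted_weight z s)) \<le> 1 + C * (norm z)\<^sup>2"
proof -
  let ?w = "\<lambda>(z::complex) b. exp (z * of_real (excess b) - of_real (block_len b * (spread / 2)) * z\<^sup>2)"
  have "\<exists>C\<ge>0. \<forall>z. norm z \<le> 1 \<longrightarrow>
    norm ((\<Sum>b\<in>block_index. of_real (rho ^ Suc (fst b)) * ?w z b) - 1) \<le> C * norm z ^ 3 \<and>
    (\<Sum>b\<in>block_index. rho ^ Suc (fst b) * norm (?w z b)) \<le> 1 + C * (norm z)\<^sup>2"
    using block_mean_1 block_mean_excess block_mean_excess_sq rho_pos
    by (intro tilted_sum_expansion finite_block_index) (simp_all add: block_mean_def)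
  then obtain C where C: "C \<ge> 0" "\<And>z. norm z \<le> 1 \<Longrightarrow>
    norm ((\<Sum>b\<in>block_index. of_real (rho ^ Suc (fst b)) * ?w z b) - 1) \<le> C * norm z ^ 3 \<and>
    (\<Sum>b\<in>block_index. rho ^ Suc (fst b) * norm (?w z b)) \<le> 1 + C * (norm z)\<^sup>2" by blast
  have 1: "(\<Sum>s<L. tilted_weight z s) = (\<Sum>b\<in>block_index. of_real (rho ^ Suc (fst b)) * ?w z b)" for z
    unfolding sum_block_index tilted_weight_eq by simp
  have 2: "(\<Sum>s<L. norm (tilted_weight z s)) \<le> (\<Sum>b\<in>block_index. rho ^ Suc (fst b) * norm (?w z b))" for z
    unfolding sum_block_index tilted_weight_eq
    using rho_pos by (intro sum_mono sum_norm_le) (simp add: norm_mult norm_power)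
  show ?thesis
    using C 1 2 order_trans by (intro exI[of _ C]) fastforce
qed

text \<open>For \<open>\<bar>z n\<bar>\<^sup>2 \<le> B / n\<close> the defect of the weights is \<open>O(n^(-3/2))\<close> and their growth \<open>O(1/n)\<close>, so
  the perturbed renewal theorem applies. Weights and initial values converge to those at
  \<open>z = 0\<close>, so one constant serves all such sequences; it is nonzero since the initial values
  at 0 are positive multiples of numbers of strings.\<close>

lemma normalized_gen_limit:
  "\<exists>A. A \<noteq> 0 \<and> (\<forall>z B. (\<forall>n. real n * (norm (z n))\<^sup>2 \<le> B) \<longrightarrow> (\<lambda>n. normalized_gen (z n) n) \<longlonglongrightarrow> A)"
proof -
  define w where "w s = c (Suc s) * rho ^ Suc s" for s
  define h where "h j = (\<Sum>s\<in>{j..<L}. w s)" for j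
  define a where "a j = real (card (legal_strings (Suc j))) * rho ^ j" for j
  have a: "normalized_gen 0 j = of_real (a j)" for j
    by (simp add: normalized_gen_def a_def gen_legal_0 cumulant_def)
  have apos: "0 < a j" for j
    using H_less_Suc[of j] rho_pos by (simp add: a_def card_legal_strings)
  have w0: "0 \<le> w s" for s using rho_pos by (simp add: w_def)
  have w1: "(\<Sum>s<L. w s) = 1" using rho_root by (simp add: w_def)
  have wpos: "0 < w 0" using rho_pos c1_pos by (simp add: w_def)
  have h0: "0 \<le> h j" for j using w0 by (simp add: h_def sum_nonneg)
  have hpos: "0 < h 0" using w1 by (simp add: h_def lessThan_atLeast0)
  define A where "A = (\<Sum>j<L. of_real (h j) * normalized_gen 0 (L - 1 - j)) / (of_real (\<Sum>j<L. h j) :: complex)"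
  have "0 < (\<Sum>j<L. h j * a (L - 1 - j))"
    using L_pos hpos h0 apos by (intro sum_pos2[of _ 0]) (auto intro!: mult_nonneg_nonneg less_imp_le[OF apos])
  moreover have "0 < (\<Sum>j<L. h j)"
    using L_pos hpos h0 by (intro sum_pos2[of _ 0]) auto
  ultimately have "0 < (\<Sum>j<L. h j * a (L - 1 - j)) / (\<Sum>j<L. h j)" by simp
  moreover have "A = of_real ((\<Sum>j<L. h j * a (L - 1 - j)) / (\<Sum>j<L. h j))"
    by (simp add: A_def a)
  ultimately have A0: "A \<noteq> 0" by (simp only: of_real_eq_0_iff)
  obtain C where C: "0 \<le> C" "\<And>z. norm z \<le> 1 \<Longrightarrow>
    norm ((\<Sum>s<L. tilted_weight z s) - 1) \<le> C * norm z ^ 3 \<and>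
    (\<Sum>s<L. norm (tilted_weight z s)) \<le> 1 + C * (norm z)\<^sup>2"
    using tilted_weight_expansion by blast
  have "(\<lambda>n. normalized_gen (z n) n) \<longlonglongrightarrow> A" if zB: "\<And>n. real n * (norm (z n))\<^sup>2 \<le> B" for z B
  proof -
    have z2: "eventually (\<lambda>n. (norm (z n))\<^sup>2 \<le> B / n) sequentially"
      using eventually_gt_at_top[of 0]
    proof eventually_elim
      case (elim n)
      then show ?case using zB[of n] by (simp add: field_simps)
    qed
    have "(\<lambda>n. (norm (z n))\<^sup>2) \<longlonglongrightarrow> 0"
      by (rule tendsto_sandwich[OF _ z2 tendsto_const lim_const_over_n]) auto
    then have "(\<lambda>n. sqrt ((norm (z n))\<^sup>2)) \<longlonglongrightarrow> sqrt 0" by (intro tendsto_intros)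
    then have nz: "(\<lambda>n. norm (z n)) \<longlonglongrightarrow> 0" by simp
    then have z: "z \<longlonglongrightarrow> 0" by (rule tendsto_norm_zero_cancel)
    have small: "eventually (\<lambda>n. norm (z n) \<le> 1) sequentially"
      using order_tendstoD(2)[OF nz, of 1] by (auto elim: eventually_mono)
    have "(\<lambda>n. normalized_gen (z n) n) \<longlonglongrightarrow>
      (\<Sum>j<L. of_real (\<Sum>s\<in>{j..<L}. w s) * normalized_gen 0 (L - 1 - j)) / of_real (\<Sum>j<L. \<Sum>s\<in>{j..<L}. w s)"
    proof (rule perturbed_renewal_limit[where u = "\<lambda>n. normalized_gen (z n)" and v = "\<lambda>n. tilted_weight (z n)" and C = "C * B"])
      show "(\<lambda>n. tilted_weight (z n) s) \<longlonglongrightarrow> of_real (w s)" for s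
      proof -
        have "(\<lambda>n. tilted_weight (z n) s) \<longlonglongrightarrow> tilted_weight 0 s"
          unfolding tilted_weight_def gen_block_def cumulant_def by (intro tendsto_intros z)
        then show ?thesis by (simp add: tilted_weight_def gen_block_def cumulant_def w_def)
      qed
      show "(\<lambda>n. normalized_gen (z n) j) \<longlonglongrightarrow> normalized_gen 0 j" for j
        unfolding normalized_gen_def gen_legal_def cumulant_def by (intro tendsto_intros z)
      show "eventually (\<lambda>n. (\<Sum>s<L. norm (tilted_weight (z n) s)) \<le> 1 + C * B / real n) sequentially"
        using small z2
      proof eventually_elim
        case (elim n)
        then show ?case using C(2)[of "z n"] mult_left_mono[OF elim(2) C(1)] by simp
      qed
      show "(\<lambda>n. real n * norm ((\<Sum>s<L. tilted_weight (z n) s) - 1)) \<longlonglongrightarrow> 0"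
      proof (rule tendsto_sandwich[where f = "\<lambda>_. 0"])
        show "(\<lambda>n. C * B * norm (z n)) \<longlonglongrightarrow> 0"
          using tendsto_mult_left[OF nz, of "C * B"] by simp
        show "eventually (\<lambda>n. real n * norm ((\<Sum>s<L. tilted_weight (z n) s) - 1) \<le> C * B * norm (z n)) sequentially"
          using small
        proof eventually_elim
          case (elim n)
          have "real n * norm ((\<Sum>s<L. tilted_weight (z n) s) - 1) \<le> real n * (C * norm (z n) ^ 3)"
            using C(2)[OF elim] by (intro mult_left_mono) auto
          also have "\<dots> = C * norm (z n) * (real n * (norm (z n))\<^sup>2)"
            by (simp add: power2_eq_square power3_eq_cube)
          also have "\<dots> \<le> C * norm (z n) * B"
            using C(1) by (intro mult_left_mono zB) auto
          finally show ?case by (simp add: mult_ac)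
        qed
      qed auto
    qed (use L_pos w0 w1 wpos normalized_gen_rec in auto)
    then show ?thesis by (simp add: A_def h_def)
  qed
  with A0 show ?thesis by blast
qed

text \<open>The integers in \<open>[H (n + 1), H (n + 2))\<close> are used with centring \<open>n * drift\<close>; the shift by one
  is immaterial in the limit. The transform is the quotient of the normalized generating
  functions at \<open>\<zeta> n / sqrt n\<close> and at 0, which have the same nonzero limit.\<close>

lemma transform_limit:
  fixes \<zeta> :: "nat \<Rightarrow> complex"
  assumes "Bseq \<zeta>"
  shows "(\<lambda>n. measure_pmf.expectation (pmf_of_set {H (Suc n)..<H (Suc (Suc n))})
      (\<lambda>N. exp (\<zeta> n * of_real ((num_summands L c H N - n * drift) / sqrt n))) * exp (- (spread / 2 * (\<zeta> n)\<^sup>2))) \<longlonglongrightarrow> 1"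
proof -
  define z where "z n = \<zeta> n / sqrt n" for n
  obtain K where K: "\<And>n. norm (\<zeta> n) \<le> K" using assms by (auto simp: Bseq_def)
  have zK: "real n * (norm (z n))\<^sup>2 \<le> K\<^sup>2" for n
  proof -
    have "real n * (norm (z n))\<^sup>2 \<le> (norm (\<zeta> n))\<^sup>2"
      by (cases "n = 0") (auto simp: z_def norm_divide power_divide)
    also have "\<dots> \<le> K\<^sup>2" using K by (intro power_mono) auto
    finally show ?thesis .
  qed
  obtain A where A: "A \<noteq> 0" "\<And>z B. (\<And>n. real n * (norm (z n))\<^sup>2 \<le> B) \<Longrightarrow> (\<lambda>n. normalized_gen (z n) n) \<longlonglongrightarrow> A"
    using normalized_gen_limit by blast
  have "(\<lambda>n. normalized_gen (z n) n / normalized_gen 0 n) \<longlonglongrightarrow> A / A"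
    using A(2)[of z "K\<^sup>2"] zK A(2)[of "\<lambda>_. 0" 0] A(1) by (intro tendsto_divide) auto
  then have "(\<lambda>n. normalized_gen (z n) n / normalized_gen 0 n) \<longlonglongrightarrow> 1" using A(1) by simp
  moreover have "eventually (\<lambda>n. normalized_gen (z n) n / normalized_gen 0 n =
     measure_pmf.expectation (pmf_of_set {H (Suc n)..<H (Suc (Suc n))})
      (\<lambda>N. exp (\<zeta> n * of_real ((num_summands L c H N - n * drift) / sqrt n))) * exp (- (spread / 2 * (\<zeta> n)\<^sup>2))) sequentially"
    using eventually_gt_at_top[of 0]
  proof eventually_elim
    case (elim n)
    let ?S = "{H (Suc n)..<H (Suc (Suc n))}"
    have S: "?S \<noteq> {}" "finite ?S" using H_less_Suc[of n] by auto
    have *: "exp (\<zeta> n * of_real ((real k - n * drift) / sqrt n)) * exp (- (spread / 2 * (\<zeta> n)\<^sup>2)) =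
        exp (z n * of_nat k) * exp (- (of_nat n * cumulant (z n)))" for k :: nat
    proof -
      have "\<zeta> n = z n * sqrt n" using elim by (simp add: z_def)
      moreover have "complex_of_real (sqrt n) * complex_of_real (sqrt n) = of_nat n"
        by (simp flip: of_real_mult)
      ultimately have "\<zeta> n * of_real ((real k - n * drift) / sqrt n) - spread / 2 * (\<zeta> n)\<^sup>2
          = z n * of_nat k - of_nat n * cumulant (z n)"
        using elim by (simp add: cumulant_def power2_eq_square field_simps)
      then show ?thesis by (simp flip: exp_add)
    qed
    have "measure_pmf.expectation (pmf_of_set ?S)
      (\<lambda>N. exp (\<zeta> n * of_real ((num_summands L c H N - n * drift) / sqrt n))) * exp (- (spread / 2 * (\<zeta> n)\<^sup>2))
      = (\<Sum>N\<in>?S. exp (z n * of_nat (num_summands L c H N)) * exp (- (of_nat n * cumulant (z n)))) / card ?S"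
      unfolding *[symmetric] using S by (subst integral_measure_pmf[of ?S])
        (auto simp: pmf_of_set sum_distrib_right scaleR_conv_of_real sum_divide_distrib)
    also have "(\<Sum>N\<in>?S. exp (z n * of_nat (num_summands L c H N)) * exp (- (of_nat n * cumulant (z n)))) =
      gen_legal (z n) n * exp (- (of_nat n * cumulant (z n)))"
      unfolding sum_distrib_right[symmetric] gen_legal_def by (subst sum_num_summands[where g = "\<lambda>k. exp (z n * of_nat k)"]) simp
    also have "\<dots> / card ?S = normalized_gen (z n) n / normalized_gen 0 n"
      using rho_pos by (simp add: normalized_gen_def gen_legal_0 cumulant_def card_legal_strings)
    finally show ?case by simp
  qed
  ultimately show ?thesis by (rule Lim_transform_eventually)
qed

theorem summands_clt:
  shows "mean_summands L c H \<in> \<Theta>(\<lambda>n. real n)"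
    and "variance_summands L c H \<in> \<Theta>(\<lambda>n. real n)"
    and "weak_conv_m
           (\<lambda>n. distr (measure_pmf (pmf_of_set {H n..<H (n + 1)})) borel
              (\<lambda>N. (real (num_summands L c H N) - mean_summands L c H n)
                     / sqrt (variance_summands L c H n)))
           std_normal_distribution" (is "weak_conv_m ?M _")
proof -
  define p where "p n = pmf_of_set {H (Suc n)..<H (Suc (Suc n))}" for n
  define K where "K N = real (num_summands L c H N)" for N
  define X where "X n N = (K N - n * drift) / sqrt n" for n :: nat and N
  define m where "m n = measure_pmf.expectation (p n) (X n)" for n
  define V where "V n = measure_pmf.variance (p n) (X n)" for n
  have fin: "finite (set_pmf (p n))" for n
    using H_less_Suc[of n] by (simp add: p_def)
  have int [simp, intro]: "integrable (measure_pmf (p n)) f" for n and f :: "nat \<Rightarrow> real"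
    by (rule integrable_measure_pmf_finite[OF fin])
  have transform: "(\<lambda>n. measure_pmf.expectation (p n) (\<lambda>N. exp (\<zeta> n * X n N)) * exp (- (spread / 2 * (\<zeta> n)\<^sup>2))) \<longlonglongrightarrow> 1"
    if "Bseq \<zeta>" for \<zeta> :: "nat \<Rightarrow> complex"
    unfolding p_def X_def K_def using that by (rule transform_limit)
  note clt = clt_from_exponential_transforms[of p spread X, OF fin spread_pos transform, folded m_def V_def]
  have K_eq: "K N = n * drift + sqrt n * X n N" if "0 < n" for n :: nat and N
    using that by (simp add: X_def)
  have mean: "mean_summands L c H (Suc n) = n * drift + sqrt n * m n" if "0 < n" for n :: nat
  proof -
    have "mean_summands L c H (Suc n) = measure_pmf.expectation (p n) (\<lambda>N. n * drift + sqrt n * X n N)"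
      unfolding K_eq[OF that, symmetric] by (simp add: mean_summands_def p_def K_def)
    then show ?thesis by (simp add: m_def)
  qed
  have centred: "K N - mean_summands L c H (Suc n) = sqrt n * (X n N - m n)" if "0 < n" for n :: nat and N
    using K_eq[OF that, of N] mean[OF that] by (simp add: right_diff_distrib)
  have variance: "variance_summands L c H (Suc n) = n * V n" if "0 < n" for n :: nat
  proof -
    have "variance_summands L c H (Suc n) =
        measure_pmf.expectation (p n) (\<lambda>N. (K N - mean_summands L c H (Suc n))\<^sup>2)"
      by (simp add: variance_summands_def mean_summands_def p_def K_def)
    also have "\<dots> = measure_pmf.expectation (p n) (\<lambda>N. n * (X n N - m n)\<^sup>2)"
      by (simp add: centred[OF that] power_mult_distrib)
    also have "\<dots> = n * V n" by (simp add: V_def m_def)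
    finally show ?thesis .
  qed
  \<comment> \<open>Passes from the index shifted by one back to \<open>n\<close>.\<close>
  have linear: "f \<in> \<Theta>(\<lambda>n. real n)"
    if "a > 0" "g \<longlonglongrightarrow> a" "\<And>n. 0 < n \<Longrightarrow> f (Suc n) = n * g n" for f g :: "nat \<Rightarrow> real" and a
  proof (rule bigthetaI_tendsto)
    have "(\<lambda>n. real n / real (Suc n) * g n) \<longlonglongrightarrow> 1 * a"
      by (intro tendsto_mult LIMSEQ_n_over_Suc_n that)
    moreover have "eventually (\<lambda>n. real n / real (Suc n) * g n = f (Suc n) / real (Suc n)) sequentially"
      using eventually_gt_at_top[of 0] by eventually_elim (simp add: that)
    ultimately have "(\<lambda>n. f (Suc n) / real (Suc n)) \<longlonglongrightarrow> a"
      using Lim_transform_eventually by fastforce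
    then show "(\<lambda>n. f n / real n) \<longlonglongrightarrow> a" by (rule LIMSEQ_imp_Suc)
  qed (use that in simp)
  show "mean_summands L c H \<in> \<Theta>(\<lambda>n. real n)"
  proof (rule linear[OF drift_pos])
    have "(\<lambda>n. m n * (1 / sqrt n)) \<longlonglongrightarrow> 0 * 0"
      by (intro tendsto_mult clt(1) tendsto_divide_0[OF tendsto_const] filterlim_at_top_imp_at_infinity
        filterlim_compose[OF sqrt_at_top filterlim_real_sequentially])
    from tendsto_add[OF tendsto_const this, of drift]
    show "(\<lambda>n. drift + m n * (1 / sqrt n)) \<longlonglongrightarrow> drift" by simp
    show "mean_summands L c H (Suc n) = n * (drift + m n * (1 / sqrt n))" if "0 < n" for n
    proof -
      have "n * (m n * (1 / sqrt n)) = sqrt n * m n"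
        using arg_cong[OF real_div_sqrt[of "real n"], of "\<lambda>x. x * m n"] by simp
      then show ?thesis by (simp only: mean[OF that] distrib_left)
    qed
  qed
  show "variance_summands L c H \<in> \<Theta>(\<lambda>n. real n)"
    by (rule linear[OF spread_pos clt(2) variance])
  show "weak_conv_m ?M std_normal_distribution"
  proof (rule levy_continuity)
    show "real_distribution (?M n)" for n
      by (intro prob_space.real_distribution_distr[OF measure_pmf.prob_space_axioms]) simp
    show "real_distribution std_normal_distribution" by (rule real_dist_normal_dist)
    fix t :: real
    have char_eq: "char (?M (Suc n)) t =
        measure_pmf.expectation (p n) (\<lambda>N. exp (\<i> * of_real (t * ((X n N - m n) / sqrt (V n)))))" if "0 < n" for n
    proof -
      have "(K N - mean_summands L c H (Suc n)) / sqrt (variance_summands L c H (Suc n)) = (X n N - m n) / sqrt (V n)" for N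
        using that by (simp add: centred variance real_sqrt_mult)
      then show ?thesis
        by (simp add: char_def integral_distr p_def K_def)
    qed
    have "eventually (\<lambda>n. measure_pmf.expectation (p n) (\<lambda>N. exp (\<i> * of_real (t * ((X n N - m n) / sqrt (V n))))) = char (?M (Suc n)) t) sequentially"
      using eventually_gt_at_top[of 0] by eventually_elim (rule char_eq[symmetric])
    then have "(\<lambda>n. char (?M (Suc n)) t) \<longlonglongrightarrow> exp (- (t\<^sup>2 / 2))"
      by (rule Lim_transform_eventually[rotated]) (rule clt(3))
    then show "(\<lambda>n. char (?M n) t) \<longlonglongrightarrow> char std_normal_distribution t"
      by (intro LIMSEQ_imp_Suc[of "\<lambda>n. char (?M n) t"]) (simp add: char_std_normal_distribution)
  qed
qed

end

theorem theorem1p3: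
  fixes L :: nat and c H :: "nat \<Rightarrow> nat"
  assumes "positive_linear_recurrence L c H"
  shows "mean_summands L c H \<in> \<Theta>(\<lambda>n. real n)
       \<and> variance_summands L c H \<in> \<Theta>(\<lambda>n. real n)
       \<and> weak_conv_m
           (\<lambda>n. distr (measure_pmf (pmf_of_set {H n..<H (n + 1)})) borel
              (\<lambda>N. (real (num_summands L c H N) - mean_summands L c H n)
                     / sqrt (variance_summands L c H n)))
           std_normal_distribution"
proof -
  interpret plrs L c H using assms by unfold_locales
  show ?thesis using summands_clt by blast
qed

end
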